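(* For every integer $m\ge 2$ and every $\tau\in\mathbb{H}$, \[ q\frac{d}{dq}E^{*}_{2m-2}=\frac{2m-2}{\pi^{2}\lambda(2m-2)}\sum_{k=1}^{m-1}\lambda(2k)\lambda(2m-2k)\left(E_{2k}^{*}E_{2m-2k}^{*}-E_{2m}^{*}\right). \]
   Context: $\mathbb{H}=\{\tau\in\mathbb{C}:\operatorname{Im}\tau>0\}$, $q=e^{2\pi i\tau}$, and $q\frac{d}{dq}$ denotes $\frac{1}{2\pi i}\frac{d}{d\tau}$. $\zeta$ is the Riemann zeta function and $\lambda(2k)=(1-2^{-2k})\zeta(2k)$. The Bernoulli numbers $B_n$ are defined by $\frac{x}{e^x-1}=\sum_{n\ge0}\frac{B_n}{n!}x^n$. For $n\ge1$ and $s\ge1$, $\sigma^{*}_{s}(n)=-\sum_{d\mid n}(-1)^{d}d^{s}$. For $k\ge1$ the level-2 Eisenstein series is \[ E^{*}_{2k}(\tau)=1-\frac{1}{1-2^{2k}}\cdot\frac{4k}{B_{2k}}\sum_{n=1}^{\infty}\sigma^{*}_{2k-1}(n)q^{n}. \] *)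

theory Defs
  imports "HOL-Analysis.Analysis" "HOL-Computational_Algebra.Formal_Power_Series"
begin

text \<open>The Dirichlet series represents the Riemann zeta function only for \<open>Re s > 1\<close>;
  it is used here only at positive even integers.\<close>

definition riemann_zeta :: "complex \<Rightarrow> complex" where
  "riemann_zeta s = (\<Sum>n. 1 / (of_nat (Suc n) powr s))"

definition dirichlet_lambda :: "complex \<Rightarrow> complex" where
  "dirichlet_lambda s = (1 - 2 powr (- s)) * riemann_zeta s"

definition bernoulli :: "nat \<Rightarrow> real" where
  "bernoulli n = fact n * fps_nth (fps_X / (fps_exp 1 - 1)) n"

definition sigma_star :: "nat \<Rightarrow> nat \<Rightarrow> int" where
  "sigma_star s n = - (\<Sum>d | d dvd n. (-1) ^ d * int d ^ s)"

definition q_of :: "complex \<Rightarrow> complex" where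
  "q_of \<tau> = exp (2 * of_real pi * \<i> * \<tau>)"

text \<open>The index is half the weight: \<open>E_star k\<close> is the series $E^*_{2k}$.\<close>

definition E_star :: "nat \<Rightarrow> complex \<Rightarrow> complex" where
  "E_star k \<tau> =
     1 - 1 / (1 - 2 ^ (2 * k)) * (4 * of_nat k / of_real (bernoulli (2 * k))) *
       (\<Sum>n. of_int (sigma_star (2 * k - 1) (Suc n)) * q_of \<tau> ^ Suc n)"

text \<open>The operator $q \frac{d}{dq}$, acting on functions of \<open>\<tau>\<close>.\<close>

definition q_deriv :: "(complex \<Rightarrow> complex) \<Rightarrow> complex \<Rightarrow> complex" where
  "q_deriv f \<tau> = 1 / (2 * of_real pi * \<i>) * deriv f \<tau>"

end

theory Submission
  imports Defs
begin

text \<open>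
  Write \<open>T\<close> for the power series of \<open>tanh (x / 2)\<close>. Its coefficients satisfy
  \<open>(2k)! T(2k-1) = -2 (1 - 2^(2k)) B(2k)\<close>, and also
  \<open>T(2k-1) = 4 (-1)^(k+1) \<lambda>(2k) / \<pi>^(2k)\<close>: the equation \<open>2 T' = 1 - T^2\<close> is the same quadratic recurrence
  as \<open>\<Sum>k. \<lambda>(2k) \<lambda>(2m-2k) = (m - 1/2) \<lambda>(2m)\<close>, which follows by partial fractions from
  \<open>\<Sum>b\<noteq>a. 1 / (b^2 - a^2) = 1 / (4 a^2)\<close> over odd \<open>b\<close>. Thus
  \<open>T(2k-1) E*(2k) = T(2k-1) + 4 / (2k-1)! \<Sum>n. \<sigma>*(2k-1, n) q^n\<close>, and comparing coefficients of \<open>q^n\<close>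
  turns the theorem into a convolution identity for the divisor sums. By the binomial theorem the convolution
  is a sum of \<open>F (a + b) - F (a - b)\<close> over \<open>a x + b y = n\<close> with \<open>F l = (-1)^l l^(2m-2)\<close>, which Liouville's
  elementary identity evaluates; the partial sums of \<open>F\<close> that it produces are the terms linear in \<open>T\<close>.
\<close>

section \<open>Liouville's identity\<close>

text \<open>Each of the two summands of \<open>n\<close> comes with a divisor (\<open>a\<close>,
  \<open>b\<close>) and its cofactor (\<open>x\<close>, \<open>y\<close>). Keeping the cofactors
  makes the Euclidean substitutions below bijective.\<close>

definition quad :: "nat \<Rightarrow> (nat \<times> nat \<times> nat \<times> nat) set" where
  "quad n = {(a, x, b, y). 0 < a \<and> 0 < x \<and> 0 < b \<and> 0 < y \<and> a * x + b * y = n}"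

lemma le_mult_add:
  fixes a x b y :: nat
  assumes "0 < a" "0 < x" "0 < b" "0 < y" "a * x + b * y = n"
  shows "a \<le> n" "x \<le> n" "b \<le> n" "y \<le> n"
proof -
  have "a * 1 \<le> a * x" "1 * x \<le> a * x" "b * 1 \<le> b * y" "1 * y \<le> b * y"
    using assms by (intro mult_le_mono; simp)+
  then show "a \<le> n" "x \<le> n" "b \<le> n" "y \<le> n" using assms(5) by linarith+
qed

lemma finite_quad [simp]: "finite (quad n)"
proof (rule finite_subset)
  show "quad n \<subseteq> {..n} \<times> {..n} \<times> {..n} \<times> {..n}"
    unfolding quad_def by clarify (metis SigmaI atMost_iff le_mult_add)
qed auto

text \<open>For \<open>u\<close>, \<open>v\<close> either the two divisors or the two cofactors;
  comparing these two splittings of one sum drives Liouville's identity.\<close>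

lemma sum_quad_trichotomy:
  fixes g :: "nat \<times> nat \<times> nat \<times> nat \<Rightarrow> int" and u v :: "nat \<times> nat \<times> nat \<times> nat \<Rightarrow> nat"
  shows "sum g (quad n) = sum g {t \<in> quad n. u t < v t} + sum g {t \<in> quad n. u t = v t}
      + sum g {t \<in> quad n. v t < u t}"
proof -
  have eq: "quad n = {t \<in> quad n. u t < v t} \<union> {t \<in> quad n. u t = v t} \<union> {t \<in> quad n. u t > v t}"
    by auto
  show ?thesis
    by (subst eq, subst sum.union_disjoint, simp, simp, force, subst sum.union_disjoint)
       (simp, simp, force, simp)
qed

abbreviation (input) q1 :: "nat \<times> nat \<times> nat \<times> nat \<Rightarrow> nat" where "q1 t \<equiv> fst t"
abbreviation (input) q2 :: "nat \<times> nat \<times> nat \<times> nat \<Rightarrow> nat" where "q2 t \<equiv> fst (snd t)"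
abbreviation (input) q3 :: "nat \<times> nat \<times> nat \<times> nat \<Rightarrow> nat" where "q3 t \<equiv> fst (snd (snd t))"
abbreviation (input) q4 :: "nat \<times> nat \<times> nat \<times> nat \<Rightarrow> nat" where "q4 t \<equiv> snd (snd (snd t))"

text \<open>With \<open>a = b = d\<close> the equation reads \<open>d * (x + y) = n\<close>, so
  \<open>d\<close> divides \<open>n\<close> and \<open>x\<close> is free in
  \<open>1..<n div d\<close>.\<close>

lemma sum_quad_fst_eq_third:
  fixes g :: "nat \<Rightarrow> int"
  assumes "n > 0"
  shows "(\<Sum>t | t \<in> quad n \<and> q1 t = q3 t. g (q1 t)) = (\<Sum>d | d dvd n. int (n div d - 1) * g d)"
proof -
  have *: "d * x + d * (n div d - x) = n" if "d dvd n" "x < n div d" for d x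
    using that by (simp flip: distrib_left)
  have "(\<Sum>d | d dvd n. int (n div d - 1) * g d) = (\<Sum>d | d dvd n. \<Sum>x \<in> {1..<n div d}. g d)"
    by simp
  also have "\<dots> = (\<Sum>(d, x) \<in> (SIGMA d:{d. d dvd n}. {1..<n div d}). g d)"
    using assms by (subst sum.Sigma) auto
  also have "\<dots> = (\<Sum>t | t \<in> quad n \<and> q1 t = q3 t. g (q1 t))"
    by (rule sum.reindex_bij_witness[where i = "\<lambda>(a, x, b, y). (a, x)"
          and j = "\<lambda>(d, x). (d, x, d, n div d - x)"])
       (use assms * in \<open>auto simp: quad_def simp flip: distrib_left intro!: gr0I\<close>)
  finally show ?thesis ..
qed

text \<open>With \<open>x = y\<close> the equation reads \<open>(a + b) * x = n\<close>, so
  \<open>d = a + b\<close> divides \<open>n\<close> and \<open>l = a\<close> is free in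
  \<open>1..<d\<close>. The weight sees both, because values of \<open>f\<close> at \<open>a\<close>
  and at \<open>a + b\<close> are summed later.\<close>

lemma sum_quad_snd_eq_fourth:
  fixes g :: "nat \<Rightarrow> nat \<Rightarrow> int"
  assumes "n > 0"
  shows "(\<Sum>t | t \<in> quad n \<and> q2 t = q4 t. g (q1 t) (q1 t + q3 t)) =
    (\<Sum>d | d dvd n. \<Sum>l = 1..<d. g l d)"
proof -
  have *: "l * (n div d) + (d - l) * (n div d) = n" if "d dvd n" "l < d" for d l
    using that by (simp flip: distrib_right)
  have "(\<Sum>d | d dvd n. \<Sum>l = 1..<d. g l d) =
      (\<Sum>(d, l) \<in> (SIGMA d:{d. d dvd n}. {1..<d}). g l d)"
    using assms by (subst sum.Sigma) auto
  also have "\<dots> = (\<Sum>t | t \<in> quad n \<and> q2 t = q4 t. g (q1 t) (q1 t + q3 t))"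
    by (rule sum.reindex_bij_witness[where i = "\<lambda>(a, x, b, y). (a + b, a)"
          and j = "\<lambda>(d, l). (l, n div d, d - l, n div d)"])
       (use assms * in \<open>auto simp: quad_def simp flip: distrib_right intro!: gr0I
          simp: dvd_div_eq_0_iff\<close>)
  finally show ?thesis ..
qed

text \<open>Up to diagonal terms, Euclidean substitutions turn the sums of \<open>f (a - b)\<close>
  and \<open>f (a + b)\<close> into twice the sum of \<open>f a\<close> over the regions
  \<open>x < y\<close> and \<open>b < a\<close> respectively. The difference of these two regional
  sums is again diagonal, and diagonals are sums over the divisors of \<open>n\<close>.\<close>

theorem liouville_identity:
  fixes f :: "int \<Rightarrow> int"
  assumes "n > 0" and even: "\<And>x. f (- x) = f x"
  shows "(\<Sum>(a, x, b, y) \<in> quad n. f (int a - int b) - f (int a + int b)) =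
    (\<Sum>d | d dvd n. int (n div d - 1) * (f 0 + 2 * f (int d)) - (int d - 1) * f (int d)
       - 2 * (\<Sum>l = 1..<d. f (int l)))"
proof -
  let ?S = "\<lambda>P. \<Sum>t | t \<in> quad n \<and> P t. f (int (q1 t))"
  have minus: "(\<Sum>t \<in> quad n. f (int (q1 t) - int (q3 t))) =
      2 * ?S (\<lambda>t. q2 t < q4 t) + (\<Sum>d | d dvd n. int (n div d - 1) * f 0)"
  proof -
    \<comment> \<open>From \<open>a * x + b * y = (a - b) * x + b * (x + y)\<close>; in the new
      tuple the second cofactor exceeds the first.\<close>
    have gt: "(\<Sum>t | t \<in> quad n \<and> q3 t < q1 t. f (int (q1 t) - int (q3 t))) = ?S (\<lambda>t. q2 t < q4 t)"
      by (rule sum.reindex_bij_witness[where j = "\<lambda>(a, x, b, y). (a - b, x, b, x + y)"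
            and i = "\<lambda>(a, x, b, y). (a + b, x, b, y - x)"])
         (auto simp: quad_def algebra_simps dest!: less_imp_Suc_add)
    \<comment> \<open>Interchanging the two products negates the argument, and \<open>f\<close> is
      even.\<close>
    have lt: "(\<Sum>t | t \<in> quad n \<and> q1 t < q3 t. f (int (q1 t) - int (q3 t))) =
        (\<Sum>t | t \<in> quad n \<and> q3 t < q1 t. f (int (q1 t) - int (q3 t)))"
      by (rule sum.reindex_bij_witness[where j = "\<lambda>(a, x, b, y). (b, y, a, x)"
            and i = "\<lambda>(a, x, b, y). (b, y, a, x)"])
         (auto simp: quad_def algebra_simps, metis even minus_diff_eq)
    have "(\<Sum>t | t \<in> quad n \<and> q1 t = q3 t. f (int (q1 t) - int (q3 t))) =
        (\<Sum>t | t \<in> quad n \<and> q1 t = q3 t. f 0)"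
      by (rule sum.cong) auto
    also have "\<dots> = (\<Sum>d | d dvd n. int (n div d - 1) * f 0)"
      by (rule sum_quad_fst_eq_third[OF assms(1)])
    finally show ?thesis
      using sum_quad_trichotomy[of _ n q1 q3] gt lt by simp
  qed
  have plus: "(\<Sum>t \<in> quad n. f (int (q1 t) + int (q3 t))) =
      2 * ?S (\<lambda>t. q3 t < q1 t) + (\<Sum>d | d dvd n. (int d - 1) * f (int d))"
  proof -
    \<comment> \<open>From \<open>a * x + b * y = (a + b) * y + a * (x - y)\<close>; in the new
      tuple the first divisor exceeds the second.\<close>
    have gt: "(\<Sum>t | t \<in> quad n \<and> q4 t < q2 t. f (int (q1 t) + int (q3 t))) = ?S (\<lambda>t. q3 t < q1 t)"
      by (rule sum.reindex_bij_witness[where j = "\<lambda>(a, x, b, y). (a + b, y, a, x - y)"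
            and i = "\<lambda>(a, x, b, y). (b, x + y, a - b, x)"])
         (auto simp: quad_def algebra_simps dest!: less_imp_Suc_add)
    have lt: "(\<Sum>t | t \<in> quad n \<and> q2 t < q4 t. f (int (q1 t) + int (q3 t))) =
        (\<Sum>t | t \<in> quad n \<and> q4 t < q2 t. f (int (q1 t) + int (q3 t)))"
      by (rule sum.reindex_bij_witness[where j = "\<lambda>(a, x, b, y). (b, y, a, x)"
            and i = "\<lambda>(a, x, b, y). (b, y, a, x)"])
         (auto simp: quad_def algebra_simps dest!: less_imp_Suc_add)
    have "(\<Sum>t | t \<in> quad n \<and> q2 t = q4 t. f (int (q1 t) + int (q3 t))) =
        (\<Sum>d | d dvd n. \<Sum>l = 1..<d. f (int d))"
      using sum_quad_snd_eq_fourth[OF assms(1), of "\<lambda>l d. f (int d)"] by simp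
    also have "\<dots> = (\<Sum>d | d dvd n. (int d - 1) * f (int d))"
      using assms(1) by (intro sum.cong) (auto simp: of_nat_diff Suc_le_eq intro!: gr0I)
    finally show ?thesis
      using sum_quad_trichotomy[of _ n q2 q4] gt lt by simp
  qed
  \<comment> \<open>One step of the Euclidean algorithm on the two factors, keeping the argument of \<open>f\<close> fixed.\<close>
  have shift: "?S (\<lambda>t. q1 t < q3 t) = ?S (\<lambda>t. q4 t < q2 t)"
    by (rule sum.reindex_bij_witness[where j = "\<lambda>(a, x, b, y). (a, x + y, b - a, y)"
          and i = "\<lambda>(a, x, b, y). (a, x - y, a + b, y)"])
       (auto simp: quad_def algebra_simps dest!: less_imp_Suc_add)
  \<comment> \<open>The total of \<open>f (q1 t)\<close> is split once by divisors and once by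
    cofactors; \<open>shift\<close> cancels one region from each side, which leaves the two
    diagonals.\<close>
  have "?S (\<lambda>t. q2 t < q4 t) - ?S (\<lambda>t. q3 t < q1 t) = ?S (\<lambda>t. q1 t = q3 t) - ?S (\<lambda>t. q2 t = q4 t)"
    using sum_quad_trichotomy[of "\<lambda>t. f (int (q1 t))" n q1 q3]
      sum_quad_trichotomy[of "\<lambda>t. f (int (q1 t))" n q2 q4] shift by simp
  also have "\<dots> = (\<Sum>d | d dvd n. int (n div d - 1) * f (int d)) - (\<Sum>d | d dvd n. \<Sum>l = 1..<d. f (int l))"
    using sum_quad_fst_eq_third[OF assms(1), of "\<lambda>d. f (int d)"]
      sum_quad_snd_eq_fourth[OF assms(1), of "\<lambda>l d. f (int l)"] by simp
  finally have diff: "?S (\<lambda>t. q2 t < q4 t) - ?S (\<lambda>t. q3 t < q1 t) = \<dots>" .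
  have "(\<Sum>(a, x, b, y) \<in> quad n. f (int a - int b) - f (int a + int b)) =
      (\<Sum>t \<in> quad n. f (int (q1 t) - int (q3 t))) - (\<Sum>t \<in> quad n. f (int (q1 t) + int (q3 t)))"
    by (simp add: case_prod_unfold sum_subtractf)
  also have "\<dots> = 2 * (?S (\<lambda>t. q2 t < q4 t) - ?S (\<lambda>t. q3 t < q1 t)) +
      (\<Sum>d | d dvd n. int (n div d - 1) * f 0) - (\<Sum>d | d dvd n. (int d - 1) * f (int d))"
    unfolding minus plus by simp
  also have "\<dots> = (\<Sum>d | d dvd n. int (n div d - 1) * (f 0 + 2 * f (int d)) - (int d - 1) * f (int d)
       - 2 * (\<Sum>l = 1..<d. f (int l)))"
    unfolding diff
    by (simp add: sum_subtractf sum.distrib distrib_left sum_distrib_left mult.left_commute right_diff_distrib)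
  finally show ?thesis .
qed

text \<open>Every natural number divides 0, and a sum over an infinite set is 0 by default.
  Convolutions and power series may therefore include the index 0.\<close>

lemma sigma_star_0 [simp]: "sigma_star s 0 = 0"
  by (simp add: sigma_star_def)

text \<open>Choosing a divisor \<open>a\<close> of \<open>i\<close> and \<open>b\<close> of
  \<open>n - i\<close> amounts to choosing a tuple in \<open>quad n\<close> with
  \<open>i = a * x\<close>. The two minus signs of \<open>sigma_star\<close> cancel.\<close>

lemma sigma_star_convolution:
  "(\<Sum>i\<le>n. sigma_star s i * sigma_star t (n - i)) =
    (\<Sum>(a, x, b, y) \<in> quad n. (-1) ^ (a + b) * int a ^ s * int b ^ t)"
proof -
  have "(\<Sum>i\<le>n. sigma_star s i * sigma_star t (n - i)) = (\<Sum>i\<in>{0<..<n}. sigma_star s i * sigma_star t (n - i))"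
    by (rule sum.mono_neutral_right) (auto simp: not_less)
  also have "\<dots> = (\<Sum>i\<in>{0<..<n}. \<Sum>(a, b)\<in>{a. a dvd i} \<times> {b. b dvd n - i}.
      (-1) ^ (a + b) * int a ^ s * int b ^ t)"
    by (simp add: sigma_star_def sum_product sum.cartesian_product power_add mult_ac)
  also have "\<dots> = (\<Sum>(i, a, b)\<in>(SIGMA i:{0<..<n}. {a. a dvd i} \<times> {b. b dvd n - i}).
      (-1) ^ (a + b) * int a ^ s * int b ^ t)"
    by (subst sum.Sigma) auto
  also have "\<dots> = (\<Sum>(a, x, b, y) \<in> quad n. (-1) ^ (a + b) * int a ^ s * int b ^ t)"
    by (rule sum.reindex_bij_witness[where j = "\<lambda>(i, a, b). (a, i div a, b, (n - i) div b)"
          and i = "\<lambda>(a, x, b, y). (a * x, a, b)"])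
       (auto simp: quad_def intro!: gr0I simp: dvd_div_eq_0_iff)
  finally show ?thesis .
qed

section \<open>The power series of tanh (x / 2)\<close>

unbundle no vec_syntax
unbundle fps_syntax

definition tanh_half_fps :: "real fps" where
  "tanh_half_fps = (fps_exp 1 - 1) * inverse (fps_exp 1 + 1)"

lemma tanh_half_fps_mult: "tanh_half_fps * (fps_exp 1 + 1) = fps_exp 1 - 1"
proof -
  have "inverse (fps_exp 1 + 1) * (fps_exp 1 + 1 :: real fps) = 1"
    by (rule inverse_mult_eq_1) simp
  then show ?thesis
    by (simp add: tanh_half_fps_def mult.assoc)
qed

lemma fps_exp_plus_1_nz: "fps_exp 1 + 1 \<noteq> (0 :: real fps)"
  by (auto simp: fps_eq_iff intro!: exI[of _ 0])

lemma tanh_half_fps_0 [simp]: "tanh_half_fps $ 0 = 0"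
  by (simp add: tanh_half_fps_def)

text \<open>After multiplication by \<open>(e + 1) ^ 2\<close> the claim follows from
  \<open>T * (e + 1) = e - 1\<close> and the derivative of that relation; power series form an
  integral domain, so the factor cancels.\<close>

lemma tanh_half_fps_deriv: "2 * fps_deriv tanh_half_fps = 1 - tanh_half_fps ^ 2"
proof -
  define e :: "real fps" where "e = fps_exp 1"
  define T where "T = tanh_half_fps"
  have T: "T * (e + 1) = e - 1"
    using tanh_half_fps_mult by (simp add: T_def e_def)
  have "fps_deriv (T * (e + 1)) = fps_deriv (e - 1)"
    by (simp add: T)
  then have d: "fps_deriv T * (e + 1) + T * e = e"
    by (simp add: e_def algebra_simps)
  have "(2 * fps_deriv T - (1 - T ^ 2)) * (e + 1) ^ 2 =
      2 * (fps_deriv T * (e + 1) + T * e) * (e + 1) - 2 * e * (T * (e + 1))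
        - (e + 1) ^ 2 + (T * (e + 1)) ^ 2"
    by (simp add: algebra_simps power2_eq_square)
  also have "\<dots> = 0"
    unfolding d T by (simp add: algebra_simps power2_eq_square)
  finally have "(2 * fps_deriv T - (1 - T ^ 2)) * (e + 1) ^ 2 = 0" .
  then show ?thesis
    using fps_exp_plus_1_nz by (simp add: T_def e_def)
qed

text \<open>The function is odd: the series \<open>T'\<close> with \<open>x\<close> replaced by
  \<open>- x\<close> satisfies the defining relation with \<open>e'\<close> in place of
  \<open>e\<close>, and \<open>e * e' = 1\<close> then forces \<open>T + T' = 0\<close>.\<close>

lemma tanh_half_fps_even_nth:
  assumes "even n"
  shows "tanh_half_fps $ n = 0"
proof -
  define e :: "real fps" where "e = fps_exp 1"
  define e' :: "real fps" where "e' = fps_exp (- 1)"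
  define T where "T = tanh_half_fps"
  define T' where "T' = T oo (fps_const (- 1) * fps_X)"
  have T: "T * (e + 1) = e - 1"
    using tanh_half_fps_mult by (simp add: T_def e_def)
  have ee': "e * e' = 1"
    by (simp add: e_def e'_def flip: fps_exp_add_mult)
  have "(T * (e + 1)) oo (fps_const (- 1) * fps_X) = (e - 1) oo (fps_const (- 1) * fps_X)"
    by (simp only: T)
  then have T': "T' * (e' + 1) = e' - 1"
    by (simp add: T'_def e_def e'_def fps_compose_mult_distrib fps_compose_add_distrib
        fps_compose_sub_distrib del: fps_const_neg mult_minus1 mult_minus_left)
  have "(T + T') * (e + 1) = T * (e + 1) + e * (T' * (e' + 1)) + T' * (1 - e * e')"
    by (simp add: algebra_simps)
  also have "\<dots> = 0"
    unfolding T T' by (simp add: ee' right_diff_distrib)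
  finally have "(T + T') * (e + 1) = 0" .
  then have "T + T' = 0"
    using fps_exp_plus_1_nz by (simp add: e_def)
  then have "(T + T') $ n = 0"
    by simp
  moreover have "T' $ n = T $ n"
    using assms by (simp only: T'_def fps_compose_linear) simp
  ultimately show ?thesis
    by (simp add: T_def)
qed

text \<open>The upper bound is even, so the last odd index is \<open>2 * m - 3\<close>, that is
  \<open>k = m - 1\<close>.\<close>

lemma sum_odd_index:
  fixes g :: "nat \<Rightarrow> real"
  assumes "\<And>i. even i \<Longrightarrow> g i = 0" "m \<ge> 1"
  shows "(\<Sum>i\<le>2 * m - 2. g i) = (\<Sum>k = 1..m - 1. g (2 * k - 1))"
proof -
  have "(\<Sum>i\<le>2 * m - 2. g i) = (\<Sum>i | i \<le> 2 * m - 2 \<and> odd i. g i)"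
    by (rule sum.mono_neutral_right) (auto simp: assms)
  also have "\<dots> = (\<Sum>k = 1..m - 1. g (2 * k - 1))"
    by (rule sum.reindex_bij_witness[where i = "\<lambda>k. 2 * k - 1" and j = "\<lambda>i. (i + 1) div 2"])
       (use assms in \<open>auto elim!: oddE\<close>)
  finally show ?thesis .
qed

lemma tanh_half_fps_1: "tanh_half_fps $ 1 = 1 / 2"
  using arg_cong[OF tanh_half_fps_deriv, of "\<lambda>f. f $ 0"]
  by (simp add: fps_mult_nth_0 power2_eq_square numeral_fps_const)

text \<open>This is the coefficient of \<open>x ^ (2 * m - 2)\<close> in
  \<open>2 T' = 1 - T^2\<close>; for \<open>m \<ge> 2\<close> the constant 1 does not
  contribute.\<close>

lemma tanh_half_fps_recurrence:
  assumes "m \<ge> 2"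
  shows "(\<Sum>k = 1..m - 1. tanh_half_fps $ (2 * k - 1) * tanh_half_fps $ (2 * m - 2 * k - 1)) =
    - 2 * (2 * real m - 1) * tanh_half_fps $ (2 * m - 1)"
proof -
  have deriv: "(2 * fps_deriv tanh_half_fps) $ (2 * m - 2) = (1 - tanh_half_fps ^ 2) $ (2 * m - 2)"
    by (simp only: tanh_half_fps_deriv)
  have "(tanh_half_fps ^ 2) $ (2 * m - 2) =
      (\<Sum>i\<le>2 * m - 2. tanh_half_fps $ i * tanh_half_fps $ (2 * m - 2 - i))"
    by (simp add: power2_eq_square fps_mult_nth atLeast0AtMost)
  also have "\<dots> = (\<Sum>k = 1..m - 1. tanh_half_fps $ (2 * k - 1) * tanh_half_fps $ (2 * m - 2 - (2 * k - 1)))"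
    using assms by (intro sum_odd_index) (auto simp: tanh_half_fps_even_nth)
  also have "\<dots> = (\<Sum>k = 1..m - 1. tanh_half_fps $ (2 * k - 1) * tanh_half_fps $ (2 * m - 2 * k - 1))"
    by (intro sum.cong refl arg_cong2[of _ _ _ _ "\<lambda>a b. a * b"] arg_cong[of _ _ "\<lambda>i. tanh_half_fps $ i"]) auto
  finally have sq: "(tanh_half_fps ^ 2) $ (2 * m - 2) = \<dots>" .
  have "Suc (2 * m - 2) = 2 * m - 1"
    using assms by simp
  then have "2 * ((2 * real m - 1) * tanh_half_fps $ (2 * m - 1)) = - (tanh_half_fps ^ 2) $ (2 * m - 2)"
    using deriv assms by (simp add: numeral_fps_const of_nat_diff)
  then have "(tanh_half_fps ^ 2) $ (2 * m - 2) = - 2 * (2 * real m - 1) * tanh_half_fps $ (2 * m - 1)"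
    by (simp add: algebra_simps)
  then show ?thesis
    by (simp only: sq)
qed

text \<open>With \<open>b(x) = x / (e^x - 1)\<close> one has
  \<open>2 (b(x) - b(2x)) = x (1 - T(x))\<close>, and the coefficient of \<open>x ^ Suc n\<close> is
  compared. For \<open>n \<ge> 1\<close> the 1 on the right does not contribute.\<close>

lemma tanh_half_fps_bernoulli:
  assumes "n \<ge> 1"
  shows "fact (Suc n) * tanh_half_fps $ n = - 2 * (1 - 2 ^ Suc n) * bernoulli (Suc n)"
proof -
  define e :: "real fps" where "e = fps_exp 1"
  define T where "T = tanh_half_fps"
  define b where "b = fps_X / (fps_exp 1 - 1 :: real fps)"
  define b' where "b' = b oo (fps_const 2 * fps_X)"
  have T: "T * (e + 1) = e - 1"
    using tanh_half_fps_mult by (simp add: T_def e_def)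
  have nz: "e - 1 \<noteq> 0"
    by (auto simp: fps_eq_iff e_def intro!: exI[of _ 1])
  \<comment> \<open>The quotient defining \<open>b\<close> is an exact division, since
    \<open>e - 1\<close> has a simple zero at 0.\<close>
  have "subdegree (e - 1) = 1"
    by (rule subdegreeI) (auto simp: e_def)
  then have "e - 1 dvd fps_X"
    using nz by (subst fps_dvd_iff) auto
  then have b: "b * (e - 1) = fps_X"
    by (simp add: b_def e_def)
  have "(b * (e - 1)) oo (fps_const 2 * fps_X) = fps_X oo (fps_const 2 * fps_X)"
    by (simp only: b)
  then have b': "b' * (e ^ 2 - 1) = 2 * fps_X"
    by (simp add: b'_def e_def fps_compose_mult_distrib fps_compose_sub_distrib
        fps_exp_power_mult numeral_fps_const)
  have "(2 * (b - b') - fps_X * (1 - T)) * ((e + 1) * (e - 1)) =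
      2 * (b * (e - 1)) * (e + 1) - 2 * (b' * (e ^ 2 - 1)) - fps_X * (e - 1) * (e + 1)
        + fps_X * (e - 1) * (T * (e + 1))"
    by (simp add: algebra_simps power2_eq_square)
  also have "\<dots> = 0"
    unfolding T b b' by (simp add: algebra_simps)
  finally have "(2 * (b - b') - fps_X * (1 - T)) * ((e + 1) * (e - 1)) = 0" .
  then have "2 * (b - b') = fps_X * (1 - T)"
    using nz fps_exp_plus_1_nz by (simp add: e_def)
  then have "(2 * (b - b')) $ Suc n = (fps_X * (1 - T)) $ Suc n"
    by simp
  then have "T $ n = - 2 * (1 - 2 ^ Suc n) * b $ Suc n"
    using assms by (simp add: b'_def fps_compose_linear numeral_fps_const left_diff_distrib)
  then show ?thesis
    unfolding T_def by (simp add: bernoulli_def b_def)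
qed

text \<open>An alternating analogue of Faulhaber's formula. The factor after \<open>(-1) ^ d\<close>
  is, up to the factorial, a coefficient of \<open>T(x) e^(d x)\<close>. Since
  \<open>T (e^x + 1) = e^x - 1\<close>, adding the values at \<open>d\<close> and
  \<open>d + 1\<close> leaves a difference of two powers, and the alternating signs make the
  recursion telescope.\<close>

lemma tanh_half_fps_power_sum:
  assumes "m \<ge> 2"
  shows "(-1) ^ d * (fact (2 * m - 2) * (\<Sum>k = 1..m - 1. tanh_half_fps $ (2 * k - 1) *
      real d ^ (2 * m - 2 * k - 1) / fact (2 * m - 2 * k - 1))) =
    2 * (\<Sum>l = 1..<d. (-1) ^ l * real l ^ (2 * m - 2)) + (-1) ^ d * real d ^ (2 * m - 2)"
proof -
  define t where "t d = fact (2 * m - 2) * (tanh_half_fps * fps_exp (real d)) $ (2 * m - 2)" for d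
  have t_eq: "t d = fact (2 * m - 2) * (\<Sum>k = 1..m - 1. tanh_half_fps $ (2 * k - 1) *
      real d ^ (2 * m - 2 * k - 1) / fact (2 * m - 2 * k - 1))"
  proof -
    have "(tanh_half_fps * fps_exp (real d)) $ (2 * m - 2) =
      (\<Sum>i\<le>2 * m - 2. tanh_half_fps $ i * (real d ^ (2 * m - 2 - i) / fact (2 * m - 2 - i)))"
      by (simp add: fps_mult_nth atLeast0AtMost)
    also have "\<dots> = (\<Sum>k = 1..m - 1. tanh_half_fps $ (2 * k - 1) *
        (real d ^ (2 * m - 2 - (2 * k - 1)) / fact (2 * m - 2 - (2 * k - 1))))"
      using assms by (intro sum_odd_index) (auto simp: tanh_half_fps_even_nth)
    also have "\<dots> = (\<Sum>k = 1..m - 1. tanh_half_fps $ (2 * k - 1) *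
        real d ^ (2 * m - 2 * k - 1) / fact (2 * m - 2 * k - 1))"
    proof (rule sum.cong)
      fix k assume "k \<in> {1..m - 1}"
      then have "2 * m - 2 - (2 * k - 1) = 2 * m - 2 * k - 1" by auto
      then show "tanh_half_fps $ (2 * k - 1) * (real d ^ (2 * m - 2 - (2 * k - 1)) / fact (2 * m - 2 - (2 * k - 1)))
        = tanh_half_fps $ (2 * k - 1) * real d ^ (2 * m - 2 * k - 1) / fact (2 * m - 2 * k - 1)" by simp
    qed simp
    finally show ?thesis by (simp add: t_def)
  qed
  have rec: "t (Suc d) + t d = real (Suc d) ^ (2 * m - 2) - real d ^ (2 * m - 2)" for d
  proof -
    have e: "fps_exp (real (Suc d)) = fps_exp (real d) * fps_exp 1"
      by (simp flip: fps_exp_add_mult add: add.commute)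
    have "tanh_half_fps * fps_exp (real (Suc d)) + tanh_half_fps * fps_exp (real d) =
        (tanh_half_fps * (fps_exp 1 + 1)) * fps_exp (real d)"
      unfolding e by (simp add: algebra_simps)
    also have "\<dots> = fps_exp (real (Suc d)) - fps_exp (real d)"
      unfolding e tanh_half_fps_mult by (simp add: algebra_simps)
    finally have "(tanh_half_fps * fps_exp (real (Suc d)) + tanh_half_fps * fps_exp (real d)) $ (2 * m - 2)
        = (fps_exp (real (Suc d)) - fps_exp (real d)) $ (2 * m - 2)"
      by (rule arg_cong)
    then have "(tanh_half_fps * fps_exp (real (Suc d))) $ (2 * m - 2) +
        (tanh_half_fps * fps_exp (real d)) $ (2 * m - 2) =
        real (Suc d) ^ (2 * m - 2) / fact (2 * m - 2) - real d ^ (2 * m - 2) / fact (2 * m - 2)"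
      by (simp only: fps_add_nth fps_sub_nth fps_exp_nth of_nat_fact)
    then show ?thesis
      unfolding t_def by (simp flip: distrib_left add: right_diff_distrib)
  qed
  have "(-1) ^ d * t d = 2 * (\<Sum>l = 1..<d. (-1) ^ l * real l ^ (2 * m - 2)) + (-1) ^ d * real d ^ (2 * m - 2)"
  proof (induction d)
    case 0
    then show ?case using assms by (simp add: t_def tanh_half_fps_even_nth)
  next
    case (Suc d)
    \<comment> \<open>For \<open>d = 0\<close> both sums are empty, and the extra term is 0 because
      the exponent \<open>2 * m - 2\<close> is positive.\<close>
    have "(\<Sum>l = 1..<Suc d. (-1) ^ l * real l ^ (2 * m - 2)) =
        (\<Sum>l = 1..<d. (-1) ^ l * real l ^ (2 * m - 2)) + (-1) ^ d * real d ^ (2 * m - 2)"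
      using assms by (cases d) auto
    moreover have "(-1) ^ Suc d * t (Suc d) =
        (-1) ^ d * t d - (-1) ^ d * (real (Suc d) ^ (2 * m - 2) - real d ^ (2 * m - 2))"
      unfolding rec[symmetric] by (simp add: algebra_simps)
    ultimately show ?case
      using Suc by (simp add: algebra_simps)
  qed
  then show ?thesis
    by (simp only: t_eq)
qed

section \<open>Values of the lambda function at even integers\<close>

text \<open>This is \<open>\<lambda>(2k)\<close> as a sum over odd numbers, indexed by half the
  argument. An unordered sum is used so that products become double sums that can be
  rearranged.\<close>

definition odd_zeta :: "nat \<Rightarrow> real" where
  "odd_zeta k = (\<Sum>\<^sub>\<infinity>i. 1 / (2 * real i + 1) ^ (2 * k))"

lemma summable_on_inverse_even_power:
  assumes "k \<ge> 1"
  shows "(\<lambda>n. 1 / real n ^ (2 * k)) summable_on UNIV"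
  using assms inverse_power_summable[of "2 * k", where 'a = real]
  by (intro norm_summable_imp_summable_on) (simp add: inverse_eq_divide)

lemma odd_zeta_has_sum:
  assumes "k \<ge> 1"
  shows "((\<lambda>i. 1 / (2 * real i + 1) ^ (2 * k)) has_sum odd_zeta k) UNIV"
proof -
  have "(\<lambda>n. 1 / real n ^ (2 * k)) summable_on range (\<lambda>i. 2 * i + 1)"
    using summable_on_inverse_even_power[OF assms] by (rule summable_on_subset_banach) simp
  then have "(\<lambda>i. 1 / (2 * real i + 1) ^ (2 * k)) summable_on UNIV"
    by (subst (asm) summable_on_reindex) (auto simp: inj_def o_def add.commute)
  then show ?thesis
    by (simp add: odd_zeta_def)
qed

lemma odd_zeta_pos:
  assumes "k \<ge> 1"
  shows "odd_zeta k > 0"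
proof -
  have "(\<Sum>i\<in>{0}. 1 / (2 * real i + 1) ^ (2 * k)) \<le> odd_zeta k"
    by (rule finite_sum_le_has_sum[OF odd_zeta_has_sum[OF assms]]) auto
  then show ?thesis by simp
qed

text \<open>The even numbers contribute \<open>1 / 2 ^ (2 * k)\<close> times the full sum; the odd
  numbers contribute the rest.\<close>

lemma odd_zeta_eq_suminf:
  assumes "k \<ge> 1"
  shows "odd_zeta k = (1 - 1 / 2 ^ (2 * k)) * (\<Sum>n. 1 / real (Suc n) ^ (2 * k))"
    and "summable (\<lambda>n. 1 / real (Suc n) ^ (2 * k))"
proof -
  define z where "z n = 1 / real n ^ (2 * k)" for n
  define Z where "Z = (\<Sum>\<^sub>\<infinity>n. z n)"
  have Z: "(z has_sum Z) UNIV"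
    using summable_on_inverse_even_power[OF assms] unfolding z_def Z_def by (rule has_sum_infsum)
  have "(z has_sum 1 / 2 ^ (2 * k) * Z) (range (\<lambda>i. 2 * i))"
    using has_sum_cmult_right[OF Z, of "1 / 2 ^ (2 * k)"]
    by (subst has_sum_reindex) (auto simp: inj_def o_def z_def power_mult_distrib)
  moreover have "(z has_sum odd_zeta k) (range (\<lambda>i. 2 * i + 1))"
    using odd_zeta_has_sum[OF assms]
    by (subst has_sum_reindex) (auto simp: inj_def o_def z_def add.commute)
  moreover have "range (\<lambda>i. 2 * i) \<inter> range (\<lambda>i. 2 * i + 1 :: nat) = {}"
    by (auto, presburger)
  ultimately have "(z has_sum 1 / 2 ^ (2 * k) * Z + odd_zeta k)
      (range (\<lambda>i. 2 * i) \<union> range (\<lambda>i. 2 * i + 1))"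
    by (rule has_sum_Un_disjoint)
  also have "range (\<lambda>i. 2 * i) \<union> range (\<lambda>i. 2 * i + 1) = (UNIV :: nat set)"
    by (auto elim: oddE evenE simp: image_iff) presburger
  finally have eq: "1 / 2 ^ (2 * k) * Z + odd_zeta k = Z"
    using Z has_sum_unique by blast
  have "(\<lambda>n. z (Suc n)) sums Z"
    using has_sum_imp_sums[OF Z] assms by (subst sums_Suc_iff) (simp add: z_def power_0_left)
  then show "odd_zeta k = (1 - 1 / 2 ^ (2 * k)) * (\<Sum>n. 1 / real (Suc n) ^ (2 * k))"
      and "summable (\<lambda>n. 1 / real (Suc n) ^ (2 * k))"
    using eq by (simp_all add: z_def sums_iff algebra_simps)
qed

lemma dirichlet_lambda_even:
  assumes "k \<ge> 1"
  shows "dirichlet_lambda (of_nat (2 * k)) = of_real (odd_zeta k)"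
proof -
  have "riemann_zeta (of_nat (2 * k)) = (\<Sum>n. of_real (1 / real (Suc n) ^ (2 * k)))"
    unfolding riemann_zeta_def
    by (intro suminf_cong) (simp add: powr_nat' del: of_nat_Suc of_nat_mult)
  also have "\<dots> = of_real (\<Sum>n. 1 / real (Suc n) ^ (2 * k))"
    by (rule suminf_of_real[OF odd_zeta_eq_suminf(2)[OF assms], symmetric])
  finally have z: "riemann_zeta (of_nat (2 * k)) = \<dots>" .
  have "(2 :: complex) powr (- of_nat (2 * k)) = 1 / 2 ^ (2 * k)"
    using powr_nat'[of "2 :: complex" "2 * k"]
    by (simp only: powr_minus inverse_eq_divide) simp
  then show ?thesis
    unfolding dirichlet_lambda_def z odd_zeta_eq_suminf(1)[OF assms] by simp
qed

section \<open>The quadratic recurrence for lambda and its initial value\<close>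

lemma odd_zeta_1: "odd_zeta 1 = pi\<^sup>2 / 8"
proof -
  \<comment> \<open>Euler's value of \<open>\<zeta>(2)\<close>; all higher values are obtained from
    it by recurrence.\<close>
  have "(\<Sum>n. 1 / real (Suc n) ^ 2) = pi\<^sup>2 / 6"
    using sums_unique[OF inverse_squares_sums] by (simp add: add.commute)
  then show ?thesis
    using odd_zeta_eq_suminf(1)[of 1] by (simp only: mult_1_right) simp
qed

text \<open>The convention \<open>1 / 0 = 0\<close> removes the term \<open>j = i\<close>.\<close>

lemma sums_reciprocal_difference:
  "(\<lambda>j. 1 / (real j - real i) - 1 / (real j + real i + 1)) sums 0"
proof (induction i)
  case 0
  have "(\<lambda>j. 1 / real j) \<longlonglongrightarrow> 0"
    by (rule lim_1_over_n)
  from telescope_sums'[OF this] show ?case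
    by (simp add: add.commute)
next
  case (Suc i)
  have lim: "(\<lambda>j. 1 / (c + real j)) \<longlonglongrightarrow> 0" for c :: real
    by (intro tendsto_divide_0[OF tendsto_const] filterlim_at_top_imp_at_infinity
        filterlim_tendsto_add_at_top[OF tendsto_const] filterlim_real_sequentially)
  \<comment> \<open>Passing from \<open>i\<close> to \<open>i + 1\<close> adds two telescoping
    series, with sums \<open>- 1 / (i + 1)\<close> and \<open>1 / (i + 1)\<close>. The value
    \<open>1 / 0 = 0\<close> occurs consistently in consecutive terms, so it does not disturb the
    telescoping.\<close>
  have "(\<lambda>j. 1 / (real j - (real i + 1))) \<longlonglongrightarrow> 0" "(\<lambda>j. 1 / (real j + (real i + 1))) \<longlonglongrightarrow> 0"
    using lim[of "- (real i + 1)"] lim[of "real i + 1"] by (simp_all add: algebra_simps)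
  from sums_add[OF telescope_sums'[OF this(1)] telescope_sums'[OF this(2)]]
  have "(\<lambda>j. (1 / (real j - (real i + 1)) - 1 / (real j - real i)) +
      (1 / (real j + (real i + 1)) - 1 / (real j + real i + 2))) sums 0"
    by (simp add: algebra_simps divide_simps)
  from sums_add[OF this Suc] show ?case
    by (simp add: algebra_simps)
qed

lemma diff_squares_odd:
  "(2 * real j + 1)\<^sup>2 - (2 * real i + 1)\<^sup>2 = 4 * ((real j - real i) * (real j + real i + 1))"
  by (simp add: power2_eq_square algebra_simps)

text \<open>By partial fractions each term with \<open>j \<noteq> i\<close> is
  \<open>1 / (4 * (2 * i + 1))\<close> times a term of the preceding series of sum 0. At
  \<open>j = i\<close> the left side is \<open>1 / 0 = 0\<close> while that multiple is
  \<open>- 1 / (4 * (2 * i + 1)^2)\<close>, so the correction at this single index is the whole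
  sum.\<close>

lemma sums_inverse_diff_squares:
  "(\<lambda>j. 1 / ((2 * real j + 1)\<^sup>2 - (2 * real i + 1)\<^sup>2)) sums (1 / (4 * (2 * real i + 1)\<^sup>2))"
proof -
  have "(\<lambda>j. 1 / (4 * (2 * real i + 1)) * (1 / (real j - real i) - 1 / (real j + real i + 1)) +
      (if j = i then 1 / (4 * (2 * real i + 1)\<^sup>2) else 0)) sums
      (1 / (4 * (2 * real i + 1)) * 0 + 1 / (4 * (2 * real i + 1)\<^sup>2))"
    by (intro sums_add sums_mult sums_reciprocal_difference sums_single)
  moreover have "1 / (4 * (2 * real i + 1)) * (1 / (real j - real i) - 1 / (real j + real i + 1)) +
      (if j = i then 1 / (4 * (2 * real i + 1)\<^sup>2) else 0) =
      1 / ((2 * real j + 1)\<^sup>2 - (2 * real i + 1)\<^sup>2)" for j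
  proof (cases "j = i")
    case True
    then show ?thesis by (simp add: power2_eq_square)
  next
    case False
    have "1 / x - 1 / y = (y - x) / (x * y)" if "x \<noteq> 0" "y \<noteq> 0" for x y :: real
      using that by (simp add: field_simps)
    from this[of "real j - real i" "real j + real i + 1"] False
    have "1 / (real j - real i) - 1 / (real j + real i + 1) =
        (2 * real i + 1) / ((real j - real i) * (real j + real i + 1))" by simp
    moreover have "1 / (4 * c) * (c / d) = 1 / (4 * d)" if "c \<noteq> 0" for c d :: real
      using that by simp
    moreover have "2 * real i + 1 \<noteq> 0" by linarith
    ultimately show ?thesis
      using False unfolding diff_squares_odd by (simp only: if_False add_0_right)
  qed
  ultimately show ?thesis by simp
qed

text \<open>For \<open>j \<noteq> i\<close> the denominator is at least \<open>(j - i)^2\<close> in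
  absolute value, so the indices below \<open>i\<close> and those above it each contribute at most
  the sum of all inverse squares. Uniformity in \<open>i\<close> is what makes the double series
  below absolutely summable.\<close>

lemma sum_inverse_diff_squares_bounded:
  obtains C where "\<And>i F. finite F \<Longrightarrow>
    (\<Sum>j\<in>F. \<bar>1 / ((2 * real j + 1)\<^sup>2 - (2 * real i + 1)\<^sup>2)\<bar>) \<le> C"
proof -
  define z where "z n = 1 / real n ^ 2" for n
  have Z: "(z has_sum (\<Sum>\<^sub>\<infinity>n. z n)) UNIV"
    unfolding z_def using summable_on_inverse_even_power[of 1] by (intro has_sum_infsum) simp
  have image_le: "(\<Sum>j\<in>A. z (f j)) \<le> (\<Sum>\<^sub>\<infinity>n. z n)" if "finite A" "inj_on f A" for A :: "nat set" and f
  proof -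
    have "(\<Sum>j\<in>A. z (f j)) = (\<Sum>n\<in>f ` A. z n)"
      using that by (simp add: sum.reindex)
    also have "\<dots> \<le> (\<Sum>\<^sub>\<infinity>n. z n)"
      using that by (intro finite_sum_le_has_sum[OF Z]) (auto simp: z_def)
    finally show ?thesis .
  qed
  have le: "\<bar>1 / ((2 * real j + 1)\<^sup>2 - (2 * real i + 1)\<^sup>2)\<bar> \<le> z (if j < i then i - j else j - i)" for i j
  proof (cases "j = i")
    case False
    have "\<bar>real j - real i\<bar> \<le> 4 * (real j + real i + 1)" by (simp add: abs_if)
    then have "\<bar>real j - real i\<bar> * \<bar>real j - real i\<bar> \<le> \<bar>real j - real i\<bar> * (4 * (real j + real i + 1))"
      by (rule mult_left_mono) simp
    moreover have "\<bar>real j - real i\<bar> * \<bar>real j - real i\<bar> > 0" using False by (intro mult_pos_pos) auto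
    ultimately have "1 / (\<bar>real j - real i\<bar> * (4 * (real j + real i + 1))) \<le>
        1 / (\<bar>real j - real i\<bar> * \<bar>real j - real i\<bar>)"
      by (intro divide_left_mono mult_pos_pos) (auto simp: zero_less_mult_iff)
    moreover have "1 / (\<bar>real j - real i\<bar> * \<bar>real j - real i\<bar>) = z (if j < i then i - j else j - i)"
      by (auto simp: z_def of_nat_diff power2_eq_square algebra_simps)
    moreover have "\<bar>1 / ((2 * real j + 1)\<^sup>2 - (2 * real i + 1)\<^sup>2)\<bar> =
        1 / (\<bar>real j - real i\<bar> * (4 * (real j + real i + 1)))"
      unfolding diff_squares_odd by (simp add: abs_mult)
    ultimately show ?thesis by simp
  qed (simp add: z_def)
  show ?thesis
  proof (rule that[of "2 * (\<Sum>\<^sub>\<infinity>n. z n)"])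
    fix i and F :: "nat set"
    assume "finite F"
    have "(\<Sum>j\<in>F. \<bar>1 / ((2 * real j + 1)\<^sup>2 - (2 * real i + 1)\<^sup>2)\<bar>) \<le>
        (\<Sum>j\<in>F. z (if j < i then i - j else j - i))"
      by (intro sum_mono le)
    also have "\<dots> = (\<Sum>j\<in>F \<inter> {..<i}. z (i - j)) + (\<Sum>j\<in>F - {..<i}. z (j - i))"
      using \<open>finite F\<close> by (subst sum.Int_Diff[of _ _ "{..<i}"]) (auto intro!: arg_cong2[of _ _ _ _ "(+)"] sum.cong)
    also have "\<dots> \<le> (\<Sum>\<^sub>\<infinity>n. z n) + (\<Sum>\<^sub>\<infinity>n. z n)"
      using \<open>finite F\<close> by (intro add_mono image_le) (auto simp: inj_on_def)
    finally show "(\<Sum>j\<in>F. \<bar>1 / ((2 * real j + 1)\<^sup>2 - (2 * real i + 1)\<^sup>2)\<bar>) \<le> 2 * (\<Sum>\<^sub>\<infinity>n. z n)"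
      by simp
  qed
qed

text \<open>Summing over \<open>j\<close> first gives a quarter of the series of
  \<open>odd_zeta m\<close>. Absolute summability holds since the row sums are bounded by
  \<open>C * a i\<close>; it permits exchanging \<open>i\<close> and \<open>j\<close> later.\<close>

lemma has_sum_odd_kernel:
  assumes "m \<ge> 2"
  shows "((\<lambda>(i, j). 1 / (2 * real i + 1) ^ (2 * m - 2) *
      (1 / ((2 * real j + 1)\<^sup>2 - (2 * real i + 1)\<^sup>2))) has_sum (odd_zeta m / 4)) (UNIV \<times> UNIV)"
proof -
  define a where "a i = 1 / (2 * real i + 1) ^ (2 * m - 2)" for i
  define v where "v i j = 1 / ((2 * real j + 1)\<^sup>2 - (2 * real i + 1)\<^sup>2)" for i j
  have a0: "a i \<ge> 0" for i by (simp add: a_def)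
  obtain C where C: "\<And>i F. finite F \<Longrightarrow> (\<Sum>j\<in>F. \<bar>v i j\<bar>) \<le> C"
    unfolding v_def using sum_inverse_diff_squares_bounded by blast
  have abs: "(\<lambda>j. \<bar>v i j\<bar>) summable_on UNIV" for i
    using C by (intro nonneg_bdd_above_summable_on bdd_aboveI2) auto
  have abs_le: "(\<Sum>\<^sub>\<infinity>j. \<bar>v i j\<bar>) \<le> C" for i
    using C by (intro infsum_le_finite_sums abs)
  have v_sum: "(v i has_sum (1 / (4 * (2 * real i + 1)\<^sup>2))) UNIV" for i
  proof -
    have "v i summable_on UNIV"
      using abs[of i] abs_summable_summable[of "v i" UNIV] by simp
    then have "(v i has_sum infsum (v i) UNIV) UNIV" by simp
    moreover from has_sum_imp_sums[OF this] have "infsum (v i) UNIV = 1 / (4 * (2 * real i + 1)\<^sup>2)"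
      using sums_inverse_diff_squares[of i] sums_unique2 unfolding v_def by blast
    ultimately show ?thesis by simp
  qed
  have a_sum: "a summable_on UNIV"
  proof -
    have "2 * m - 2 = 2 * (m - 1)" by simp
    then show ?thesis
      using odd_zeta_has_sum[of "m - 1"] assms has_sum_imp_summable
      unfolding a_def by (metis One_nat_def diff_le_mono numeral_2_eq_2 diff_Suc_1)
  qed
  have abs2: "(\<lambda>t. norm (case t of (i, j) \<Rightarrow> a i * v i j)) summable_on UNIV \<times> UNIV"
  proof (rule iffD2[OF Infinite_Sum.abs_summable_on_Sigma_iff], intro conjI ballI)
    show "(\<lambda>j. norm (case (i, j) of (i, j) \<Rightarrow> a i * v i j)) summable_on UNIV" for i
      using summable_on_cmult_right[OF abs[of i], of "\<bar>a i\<bar>"] by (simp add: abs_mult)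
    have "(\<lambda>i. C * a i) summable_on UNIV"
      by (rule summable_on_cmult_right[OF a_sum])
    then show "(\<lambda>i. norm (\<Sum>\<^sub>\<infinity>j. norm (case (i, j) of (i, j) \<Rightarrow> a i * v i j))) summable_on UNIV"
    proof (rule Infinite_Sum.abs_summable_on_comparison_test')
      fix i
      have "(\<Sum>\<^sub>\<infinity>j. norm (case (i, j) of (i, j) \<Rightarrow> a i * v i j)) = a i * (\<Sum>\<^sub>\<infinity>j. \<bar>v i j\<bar>)"
        using a0[of i] by (simp add: abs_mult infsum_cmult_right')
      also have "\<dots> \<le> a i * C"
        by (intro mult_left_mono abs_le a0)
      moreover have "(\<Sum>\<^sub>\<infinity>j. \<bar>v i j\<bar>) \<ge> 0" by (intro infsum_nonneg) auto
      ultimately show "norm (\<Sum>\<^sub>\<infinity>j. norm (case (i, j) of (i, j) \<Rightarrow> a i * v i j)) \<le> C * a i"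
        using a0[of i] by (simp add: mult.commute)
    qed
  qed
  have "((\<lambda>(i, j). a i * v i j) has_sum (odd_zeta m / 4)) (UNIV \<times> UNIV)"
  proof (rule has_sum_SigmaI)
    show "(\<lambda>(i, j). a i * v i j) summable_on UNIV \<times> UNIV"
      using abs2 by (rule abs_summable_summable)
    show "((\<lambda>j. case (i, j) of (i, j) \<Rightarrow> a i * v i j) has_sum a i * (1 / (4 * (2 * real i + 1)\<^sup>2))) UNIV" for i
      using has_sum_cmult_right[OF v_sum] by simp
    have "((\<lambda>i. 1 / 4 * (1 / (2 * real i + 1) ^ (2 * m))) has_sum (1 / 4 * odd_zeta m)) UNIV"
      using assms by (intro has_sum_cmult_right odd_zeta_has_sum) simp
    moreover have "(2 * real i + 1) ^ (2 * m) = (2 * real i + 1) ^ (2 * m - 2) * (2 * real i + 1)\<^sup>2" for i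
      using assms by (subst power_add[symmetric]) (rule arg_cong[where f = "\<lambda>n. _ ^ n"], simp)
    ultimately show "((\<lambda>i. a i * (1 / (4 * (2 * real i + 1)\<^sup>2))) has_sum (odd_zeta m / 4)) UNIV"
      by (simp add: a_def mult_ac)
  qed
  then show ?thesis
    by (simp add: a_def v_def)
qed

lemma has_sum_finite_sum:
  fixes h :: "'k \<Rightarrow> 't \<Rightarrow> real"
  assumes "finite K" "\<And>k. k \<in> K \<Longrightarrow> (h k has_sum s k) A"
  shows "((\<lambda>t. \<Sum>k\<in>K. h k t) has_sum (\<Sum>k\<in>K. s k)) A"
  using assms by (induction K rule: finite_induct) (auto intro: has_sum_add)

text \<open>A finite geometric sum in \<open>x^2\<close> and \<open>y^2\<close>, written as a kernel
  plus its mirror image under exchanging \<open>x\<close> and \<open>y\<close>, to match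
  \<open>has_sum_odd_kernel\<close>.\<close>

lemma sum_inverse_powers_eq:
  fixes x y :: real
  assumes "x > 0" "y > 0" "x \<noteq> y" "m \<ge> 1"
  shows "(\<Sum>k = 1..m - 1. 1 / (x ^ (2 * k) * y ^ (2 * m - 2 * k))) =
    1 / x ^ (2 * m - 2) * (1 / (y\<^sup>2 - x\<^sup>2)) + 1 / y ^ (2 * m - 2) * (1 / (x\<^sup>2 - y\<^sup>2))"
proof -
  define A B where "A = x\<^sup>2" and "B = y\<^sup>2"
  have AB: "A > 0" "B > 0" "A \<noteq> B"
    using assms by (auto simp: A_def B_def)
  have "(\<Sum>k = 1..n. 1 / (A ^ k * B ^ (n + 1 - k))) = 1 / A ^ n * (1 / (B - A)) + 1 / B ^ n * (1 / (A - B))" for n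
  proof (induction n)
    case 0
    then show ?case using AB by (simp add: divide_simps)
  next
    case (Suc n)
    have "(\<Sum>k = 1..Suc n. 1 / (A ^ k * B ^ (Suc n + 1 - k))) =
        (\<Sum>k = 1..n. 1 / B * (1 / (A ^ k * B ^ (n + 1 - k)))) + 1 / (A ^ Suc n * B)"
      by (simp add: Suc_diff_le mult_ac)
    also have "\<dots> = 1 / B * (1 / A ^ n * (1 / (B - A)) + 1 / B ^ n * (1 / (A - B))) + 1 / (A ^ Suc n * B)"
      unfolding sum_distrib_left[symmetric] Suc ..
    also have "\<dots> = 1 / A ^ Suc n * (1 / (B - A)) + 1 / B ^ Suc n * (1 / (A - B))"
      using AB by (simp add: divide_simps) (simp add: algebra_simps)
    finally show ?case .
  qed
  from this[of "m - 1"] have "(\<Sum>k = 1..m - 1. 1 / (A ^ k * B ^ (m - k))) =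
      1 / A ^ (m - 1) * (1 / (B - A)) + 1 / B ^ (m - 1) * (1 / (A - B))"
    using assms by simp
  then show ?thesis
    by (simp add: A_def B_def diff_mult_distrib2 flip: power_mult)
qed

text \<open>Expand the products as double series over pairs of odd numbers. The diagonal contributes
  \<open>(m - 1) * odd_zeta m\<close>; off it, the kernel and its mirror image contribute
  \<open>odd_zeta m / 4\<close> each.\<close>

lemma odd_zeta_recurrence:
  assumes "m \<ge> 2"
  shows "(\<Sum>k = 1..m - 1. odd_zeta k * odd_zeta (m - k)) = (real m - 1 / 2) * odd_zeta m"
proof -
  define w where "w i = 2 * real i + 1" for i
  define u where "u = (\<lambda>(i, j). 1 / w i ^ (2 * m - 2) * (1 / ((w j)\<^sup>2 - (w i)\<^sup>2)))"
  define h where "h k = (\<lambda>(i, j). 1 / (w i ^ (2 * k) * w j ^ (2 * m - 2 * k)))" for k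
  define D where "D = (\<lambda>(i, j). if j = i then (real m - 1) * (1 / w i ^ (2 * m)) else 0)"
  have w: "w i > 0" for i by (simp add: w_def)
  have h: "(h k has_sum (odd_zeta k * odd_zeta (m - k))) (UNIV \<times> UNIV)" if "k \<in> {1..m - 1}" for k
  proof (rule has_sum_SigmaI)
    have k: "((\<lambda>i. 1 / w i ^ (2 * k)) has_sum odd_zeta k) UNIV"
      "((\<lambda>i. 1 / w i ^ (2 * m - 2 * k)) has_sum odd_zeta (m - k)) UNIV"
      using that odd_zeta_has_sum[of k] odd_zeta_has_sum[of "m - k"]
      by (auto simp: w_def diff_mult_distrib2)
    show row: "((\<lambda>j. h k (i, j)) has_sum (1 / w i ^ (2 * k) * odd_zeta (m - k))) UNIV" for i
      using has_sum_cmult_right[OF k(2), of "1 / w i ^ (2 * k)"] by (simp add: h_def)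
    show col: "((\<lambda>i. 1 / w i ^ (2 * k) * odd_zeta (m - k)) has_sum odd_zeta k * odd_zeta (m - k)) UNIV"
      by (rule has_sum_cmult_left[OF k(1)])
    show "h k summable_on UNIV \<times> UNIV"
      by (rule summable_on_SigmaI[OF row has_sum_imp_summable[OF col]])
         (simp add: h_def w less_imp_le)
  qed
  have u: "(u has_sum (odd_zeta m / 4)) (UNIV \<times> UNIV)"
    using has_sum_odd_kernel[OF assms] by (simp add: u_def w_def)
  then have u': "((\<lambda>(i, j). u (j, i)) has_sum (odd_zeta m / 4)) (UNIV \<times> UNIV)"
    by (subst (asm) has_sum_swap)
  have D: "(D has_sum ((real m - 1) * odd_zeta m)) (UNIV \<times> UNIV)"
  proof (rule has_sum_SigmaI)
    show row: "((\<lambda>j. D (i, j)) has_sum ((real m - 1) * (1 / w i ^ (2 * m)))) UNIV" for i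
      by (rule has_sum_finite_neutralI[where B = "{i}"]) (auto simp: D_def)
    show col: "((\<lambda>i. (real m - 1) * (1 / w i ^ (2 * m))) has_sum (real m - 1) * odd_zeta m) UNIV"
      using assms odd_zeta_has_sum[of m] by (intro has_sum_cmult_right) (auto simp: w_def)
    show "D summable_on UNIV \<times> UNIV"
      by (rule summable_on_SigmaI[OF row has_sum_imp_summable[OF col]])
         (use assms in \<open>simp add: D_def w less_imp_le\<close>)
  qed
  have "(\<Sum>k = 1..m - 1. h k t) = D t + u t + (\<lambda>(i, j). u (j, i)) t" for t
  proof (cases t)
    case (Pair i j)
    show ?thesis
    proof (cases "i = j")
      \<comment> \<open>On the diagonal both kernels are 0 by \<open>1 / 0 = 0\<close>, so
        \<open>D\<close> alone accounts for the \<open>m - 1\<close> equal terms.\<close>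
      case True
      have "h k t = 1 / w i ^ (2 * m)" if "k \<in> {1..m - 1}" for k
        using that True Pair by (auto simp: h_def simp flip: power_add)
      then have "(\<Sum>k = 1..m - 1. h k t) = (real m - 1) * (1 / w i ^ (2 * m))"
        using assms by (simp add: of_nat_diff)
      then show ?thesis
        using True Pair by (simp add: D_def u_def)
    next
      case False
      then have "w i \<noteq> w j" by (simp add: w_def)
      then have "(\<Sum>k = 1..m - 1. h k t) = u (i, j) + u (j, i)"
        using sum_inverse_powers_eq[of "w i" "w j" m] w assms by (simp add: h_def u_def Pair)
      then show ?thesis
        using False Pair by (simp add: D_def)
    qed
  qed
  moreover have "((\<lambda>t. \<Sum>k = 1..m - 1. h k t) has_sum
      (\<Sum>k = 1..m - 1. odd_zeta k * odd_zeta (m - k))) (UNIV \<times> UNIV)"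
    by (intro has_sum_finite_sum h) auto
  moreover have "((\<lambda>t. D t + u t + (\<lambda>(i, j). u (j, i)) t) has_sum
      ((real m - 1) * odd_zeta m + odd_zeta m / 4 + odd_zeta m / 4)) (UNIV \<times> UNIV)"
    by (intro has_sum_add D u u')
  ultimately have "(\<Sum>k = 1..m - 1. odd_zeta k * odd_zeta (m - k)) =
      (real m - 1) * odd_zeta m + odd_zeta m / 4 + odd_zeta m / 4"
    using has_sum_unique by auto
  then show ?thesis by (simp add: algebra_simps)
qed

text \<open>Both sides satisfy the same recurrence, because
  \<open>16 (-1)^m (m - 1/2) = - 2 (2m - 1) * 4 (-1)^(m+1)\<close>. They agree at
  \<open>k = 1\<close>, where \<open>T\<close> has coefficient \<open>1 / 2\<close> and
  \<open>\<lambda>(2) = pi^2 / 8\<close>.\<close>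

lemma tanh_half_fps_odd_zeta:
  assumes "k \<ge> 1"
  shows "tanh_half_fps $ (2 * k - 1) = 4 * (-1) ^ Suc k * odd_zeta k / pi ^ (2 * k)"
  using assms
proof (induction k rule: less_induct)
  case (less m)
  show ?case
  proof (cases "m = 1")
    case True
    then show ?thesis using tanh_half_fps_1 odd_zeta_1 by (simp only:) simp
  next
    case False
    with less.prems have m: "m \<ge> 2" by simp
    have "(- 2 * (2 * real m - 1)) * tanh_half_fps $ (2 * m - 1) =
      (\<Sum>k = 1..m - 1. tanh_half_fps $ (2 * k - 1) * tanh_half_fps $ (2 * (m - k) - 1))"
      using tanh_half_fps_recurrence[OF m] by (simp add: diff_mult_distrib2)
    also have "\<dots> = (\<Sum>k = 1..m - 1. 16 * (-1) ^ m / pi ^ (2 * m) * (odd_zeta k * odd_zeta (m - k)))"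
    proof (rule sum.cong)
      fix k assume k: "k \<in> {1..m - 1}"
      have "tanh_half_fps $ (2 * k - 1) = 4 * (-1) ^ Suc k * odd_zeta k / pi ^ (2 * k)"
        "tanh_half_fps $ (2 * (m - k) - 1) = 4 * (-1) ^ Suc (m - k) * odd_zeta (m - k) / pi ^ (2 * (m - k))"
        using k by (intro less.IH; simp; linarith)+
      moreover have "(-1 :: real) ^ Suc k * (-1) ^ Suc (m - k) = (-1) ^ m"
        "pi ^ (2 * k) * pi ^ (2 * (m - k)) = pi ^ (2 * m)"
        using k by (auto simp: diff_mult_distrib2 simp flip: power_add)
      moreover have "4 * e * x / p * (4 * e' * y / p') = 16 * (e * e') / (p * p') * (x * y)"
        for e e' x y p p' :: real by simp
      ultimately show "tanh_half_fps $ (2 * k - 1) * tanh_half_fps $ (2 * (m - k) - 1) =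
          16 * (-1) ^ m / pi ^ (2 * m) * (odd_zeta k * odd_zeta (m - k))"
        by (simp only:)
    qed simp
    also have "\<dots> = 16 * (-1) ^ m / pi ^ (2 * m) * ((real m - 1 / 2) * odd_zeta m)"
      unfolding sum_distrib_left[symmetric] odd_zeta_recurrence[OF m] ..
    also have "\<dots> = (- 2 * (2 * real m - 1)) * (4 * (-1) ^ Suc m * odd_zeta m / pi ^ (2 * m))"
      by (simp add: field_simps)
    finally show ?thesis
      using m by (subst (asm) mult_cancel_left) auto
  qed
qed

section \<open>The differential equation\<close>

text \<open>Only the odd powers of \<open>a\<close> survive in the difference of the two binomial
  expansions. The binomial coefficients are split into factorials, one for each Eisenstein
  factor.\<close>

lemma power_add_minus_power_diff:
  fixes a b :: real
  assumes "m \<ge> 1"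
  shows "(a + b) ^ (2 * m - 2) - (a - b) ^ (2 * m - 2) =
    2 * fact (2 * m - 2) * (\<Sum>k = 1..m - 1.
      a ^ (2 * k - 1) * b ^ (2 * m - 2 * k - 1) / (fact (2 * k - 1) * fact (2 * m - 2 * k - 1)))"
proof -
  let ?M = "2 * m - 2"
  \<comment> \<open>The even exponent moves the sign from \<open>b\<close> to \<open>a\<close>, so
    that it follows the summation index.\<close>
  have "(a - b) ^ ?M = (- a + b) ^ ?M"
    using power_minus_even[of ?M "a - b"] by simp
  also have "\<dots> = (\<Sum>i\<le>?M. (-1) ^ i * (of_nat (?M choose i) * a ^ i * b ^ (?M - i)))"
    unfolding binomial_ring power_minus[of a] by (simp add: mult_ac)
  finally have "(a + b) ^ ?M - (a - b) ^ ?M =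
      (\<Sum>i\<le>?M. (1 - (-1) ^ i) * (of_nat (?M choose i) * a ^ i * b ^ (?M - i)))"
    unfolding binomial_ring by (simp add: left_diff_distrib sum_subtractf)
  also have "\<dots> = (\<Sum>k = 1..m - 1. (1 - (-1) ^ (2 * k - 1)) *
      (of_nat (?M choose (2 * k - 1)) * a ^ (2 * k - 1) * b ^ (?M - (2 * k - 1))))"
    using assms by (intro sum_odd_index) auto
  also have "\<dots> = (\<Sum>k = 1..m - 1. 2 * fact ?M *
      (a ^ (2 * k - 1) * b ^ (2 * m - 2 * k - 1) / (fact (2 * k - 1) * fact (2 * m - 2 * k - 1))))"
  proof (rule sum.cong)
    fix k assume k: "k \<in> {1..m - 1}"
    then have "?M - (2 * k - 1) = 2 * m - 2 * k - 1" "2 * k - 1 \<le> ?M" "odd (2 * k - 1)" by auto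
    then show "(1 - (-1) ^ (2 * k - 1)) * (of_nat (?M choose (2 * k - 1)) * a ^ (2 * k - 1) * b ^ (?M - (2 * k - 1)))
      = 2 * fact ?M * (a ^ (2 * k - 1) * b ^ (2 * m - 2 * k - 1) / (fact (2 * k - 1) * fact (2 * m - 2 * k - 1)))"
      by (simp add: binomial_fact)
  qed simp
  finally show ?thesis
    by (simp add: sum_distrib_left)
qed

text \<open>The coefficient of \<open>q^n\<close> in the differential equation. Every term is a sum
  over \<open>d dvd n\<close>: with \<open>P\<close> the sum of \<open>F l\<close> over
  \<open>1..<d\<close>, the convolution contributes
  \<open>- 2 (n/d) F d + F d + d F d + 2 P\<close>, the linear part \<open>- 2 P - F d\<close> and
  the last term \<open>- d F d\<close>. Only \<open>- 2 (n/d) F d\<close> remains, which is the left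
  side.\<close>

lemma sigma_star_recurrence:
  assumes "m \<ge> 2"
  shows "2 * real n * of_int (sigma_star (2 * m - 3) n) =
    fact (2 * m - 2) * (\<Sum>k = 1..m - 1. tanh_half_fps $ (2 * k - 1) *
      of_int (sigma_star (2 * m - 2 * k - 1) n) / fact (2 * m - 2 * k - 1)) +
    2 * fact (2 * m - 2) * (\<Sum>k = 1..m - 1.
      of_int (\<Sum>i\<le>n. sigma_star (2 * k - 1) i * sigma_star (2 * m - 2 * k - 1) (n - i)) /
      (fact (2 * k - 1) * fact (2 * m - 2 * k - 1))) +
    of_int (sigma_star (2 * m - 1) n)"
proof (cases "n = 0")
  case False
  let ?M = "2 * m - 2"
  \<comment> \<open>Liouville's identity needs an even function on all integers, hence the absolute
    value in the sign; \<open>F\<close> is its real-valued restriction to the naturals.\<close>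
  define f :: "int \<Rightarrow> int" where "f x = (-1) ^ nat \<bar>x\<bar> * x ^ ?M" for x
  define F :: "nat \<Rightarrow> real" where "F l = (-1) ^ l * real l ^ ?M" for l
  have M: "even ?M" "?M > 0"
    using assms by auto
  have f_even: "f (- x) = f x" for x
    using M by (simp add: f_def)
  have f_nat: "of_int (f (int l)) = F l" for l
    by (simp add: f_def F_def)
  have f_add: "of_int (f (int a + int b)) = (-1) ^ (a + b) * (real a + real b) ^ ?M" for a b
    using f_nat[of "a + b"] by (simp add: F_def)
  have f_diff: "of_int (f (int a - int b)) = (-1) ^ (a + b) * (real a - real b) ^ ?M" for a b
  proof -
    \<comment> \<open>As \<open>a - b\<close> and \<open>a + b\<close> have the same parity, both
      powers carry the sign occurring in the convolution.\<close>
    have "even (nat \<bar>int a - int b\<bar>) \<longleftrightarrow> even (a + b)"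
      by (simp add: even_nat_iff)
    then have "(-1 :: real) ^ nat \<bar>int a - int b\<bar> = (-1) ^ (a + b)"
      by (simp add: minus_one_power_iff)
    then show ?thesis
      by (simp add: f_def)
  qed
  have conv: "2 * fact ?M * (\<Sum>k = 1..m - 1.
      of_int (\<Sum>i\<le>n. sigma_star (2 * k - 1) i * sigma_star (2 * m - 2 * k - 1) (n - i)) /
      (fact (2 * k - 1) * fact (2 * m - 2 * k - 1))) =
      - (\<Sum>d | d dvd n. 2 * (real n / real d - 1) * F d - (real d - 1) * F d - 2 * (\<Sum>l = 1..<d. F l))"
    (is "?L = _")
  proof -
    have "?L = (\<Sum>(a, x, b, y)\<in>quad n. (-1) ^ (a + b) * (2 * fact ?M * (\<Sum>k = 1..m - 1.
        real a ^ (2 * k - 1) * real b ^ (2 * m - 2 * k - 1) /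
        (fact (2 * k - 1) * fact (2 * m - 2 * k - 1)))))"
      unfolding sigma_star_convolution of_int_sum sum_divide_distrib sum_distrib_left case_prod_unfold
      by (subst sum.swap) (intro sum.cong refl, simp add: mult_ac)
    also have "\<dots> = (\<Sum>(a, x, b, y)\<in>quad n. (-1) ^ (a + b) *
        ((real a + real b) ^ ?M - (real a - real b) ^ ?M))"
      using assms by (subst power_add_minus_power_diff) auto
    also have "\<dots> = - of_int (\<Sum>(a, x, b, y)\<in>quad n. f (int a - int b) - f (int a + int b))"
      by (simp add: of_int_sum case_prod_unfold f_add f_diff right_diff_distrib sum_subtractf)
    also have "\<dots> = - of_int (\<Sum>d | d dvd n. int (n div d - 1) * (f 0 + 2 * f (int d))
        - (int d - 1) * f (int d) - 2 * (\<Sum>l = 1..<d. f (int l)))"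
      using False by (subst liouville_identity) (auto simp: f_even)
    also have "\<dots> = - (\<Sum>d | d dvd n. 2 * (real n / real d - 1) * F d - (real d - 1) * F d
        - 2 * (\<Sum>l = 1..<d. F l))"
    proof -
      have "real (n div d - 1) = real n / real d - 1" if "d dvd n" for d
      proof -
        have "n div d \<ge> 1"
          using that False by (metis Suc_leI One_nat_def div_greater_zero_iff dvd_imp_le dvd_pos_nat neq0_conv)
        then show ?thesis
          using that by (simp add: of_nat_diff real_of_nat_div)
      qed
      moreover have "f 0 = 0"
        using M by (simp add: f_def)
      ultimately show ?thesis
        by (simp add: of_int_sum f_nat mult_ac right_diff_distrib)
    qed
    finally show ?thesis .
  qed
  have "fact ?M * (\<Sum>k = 1..m - 1. tanh_half_fps $ (2 * k - 1) *
      of_int (sigma_star (2 * m - 2 * k - 1) n) / fact (2 * m - 2 * k - 1)) =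
      (\<Sum>k = 1..m - 1. \<Sum>d | d dvd n. - ((-1) ^ d * (fact ?M * (tanh_half_fps $ (2 * k - 1) *
        real d ^ (2 * m - 2 * k - 1) / fact (2 * m - 2 * k - 1)))))"
    by (simp add: sigma_star_def of_int_sum sum_distrib_left sum_divide_distrib sum_negf mult_ac)
  also have "\<dots> = - (\<Sum>d | d dvd n. (-1) ^ d * (fact ?M * (\<Sum>k = 1..m - 1. tanh_half_fps $ (2 * k - 1) *
        real d ^ (2 * m - 2 * k - 1) / fact (2 * m - 2 * k - 1))))"
    by (subst sum.swap) (simp add: sum_negf sum_distrib_left)
  also have "\<dots> = - (\<Sum>d | d dvd n. 2 * (\<Sum>l = 1..<d. F l) + F d)"
    by (simp only: tanh_half_fps_power_sum[OF assms] F_def)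
  finally have lin: "fact ?M * (\<Sum>k = 1..m - 1. tanh_half_fps $ (2 * k - 1) *
      of_int (sigma_star (2 * m - 2 * k - 1) n) / fact (2 * m - 2 * k - 1)) = \<dots>" .
  have last: "of_int (sigma_star (2 * m - 1) n) = - (\<Sum>d | d dvd n. real d * F d)"
  proof -
    have "2 * m - 1 = Suc ?M"
      using assms by simp
    then show ?thesis
      by (simp add: sigma_star_def of_int_sum F_def mult_ac)
  qed
  have first: "2 * real n * of_int (sigma_star (2 * m - 3) n) = - (\<Sum>d | d dvd n. 2 * (real n / real d) * F d)"
  proof -
    have "?M = Suc (2 * m - 3)"
      using assms by simp
    then have "2 * real n * ((-1) ^ d * real d ^ (2 * m - 3)) = 2 * (real n / real d) * F d" if "d dvd n" for d
      using that False by (auto simp: F_def)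
    then show ?thesis
      by (simp add: sigma_star_def of_int_sum sum_distrib_left)
  qed
  show ?thesis
    unfolding conv lin last first sum_negf[symmetric] sum.distrib[symmetric]
    by (intro sum.cong refl) (simp add: algebra_simps)
qed simp

section \<open>Convergence and differentiation of the divisor-sum series\<close>

lemma summable_power_times_power:
  fixes x :: complex
  assumes "norm x < 1"
  shows "summable (\<lambda>n. of_nat n ^ p * x ^ n)"
  using assms
proof (induction p arbitrary: x)
  case 0
  then show ?case by (simp add: summable_geometric)
next
  case (Suc p)
  \<comment> \<open>Termwise differentiation keeps convergence in the open disc; multiplying by
    \<open>x\<close> then restores the exponent.\<close>
  have "summable (\<lambda>n. diffs (\<lambda>n. of_nat n ^ p) n * x ^ n)"
    using Suc.prems Suc.IH by (rule termdiff_converges)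
  then have "summable (\<lambda>n. x * (diffs (\<lambda>n. of_nat n ^ p) n * x ^ n))"
    by (rule summable_mult)
  then have "summable (\<lambda>n. of_nat (Suc n) ^ Suc p * x ^ Suc n)"
    by (simp add: diffs_def mult_ac)
  then show ?case
    by (subst (asm) summable_Suc_iff)
qed

text \<open>There are at most \<open>n\<close> divisors, each contributing at most
  \<open>n ^ s\<close>.\<close>

lemma sigma_star_bound: "\<bar>sigma_star s n\<bar> \<le> int n ^ Suc s"
proof (cases "n = 0")
  case False
  have sub: "{d. d dvd n} \<subseteq> {1..n}"
    using False by (auto dest: dvd_imp_le intro: Suc_leI)
  have "\<bar>sigma_star s n\<bar> \<le> (\<Sum>d | d dvd n. \<bar>(-1) ^ d * int d ^ s\<bar>)"
    unfolding sigma_star_def abs_minus_cancel by (rule sum_abs)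
  also have "\<dots> \<le> (\<Sum>d | d dvd n. int n ^ s)"
    using sub by (intro sum_mono) (auto simp: abs_mult power_abs intro!: power_mono)
  also have "\<dots> \<le> int n * int n ^ s"
    using card_mono[OF _ sub] by (auto intro!: mult_right_mono)
  finally show ?thesis by simp
qed simp

text \<open>A function of \<open>q\<close> rather than \<open>\<tau>\<close>, so that the operator
  becomes an ordinary derivative times \<open>q\<close>. Starting at index 0 suits Cauchy products;
  that term is 0.\<close>

definition sigma_series :: "nat \<Rightarrow> complex \<Rightarrow> complex" where
  "sigma_series s q = (\<Sum>n. of_int (sigma_star s n) * q ^ n)"

lemma sigma_series_summable:
  fixes q :: complex
  assumes "norm q < 1"
  shows "summable (\<lambda>n. norm (of_int (sigma_star s n) * q ^ n))"
proof (rule summable_comparison_test)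
  have "summable (\<lambda>n. of_nat n ^ Suc s * of_real (norm q) ^ n :: complex)"
    using assms by (intro summable_power_times_power) simp
  then have "summable (\<lambda>n. complex_of_real (real n ^ Suc s * norm q ^ n))"
    by simp
  then show "summable (\<lambda>n. real n ^ Suc s * norm q ^ n)"
    by (simp only: summable_complex_of_real)
  have "norm (of_int (sigma_star s n) * q ^ n) \<le> real n ^ Suc s * norm q ^ n" for n
  proof -
    have "real_of_int \<bar>sigma_star s n\<bar> \<le> real_of_int (int n ^ Suc s)"
      using sigma_star_bound by (simp only: of_int_le_iff)
    then have "\<bar>real_of_int (sigma_star s n)\<bar> * norm q ^ n \<le> real n ^ Suc s * norm q ^ n"
      by (intro mult_right_mono) auto
    then show ?thesis
      by (simp add: norm_mult norm_power)
  qed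
  then show "\<exists>N. \<forall>n\<ge>N. norm (norm (of_int (sigma_star s n) * q ^ n)) \<le> real n ^ Suc s * norm q ^ n"
    by simp
qed

lemma sigma_series_sums:
  fixes q :: complex
  assumes "norm q < 1"
  shows "(\<lambda>n. of_int (sigma_star s n) * q ^ n) sums sigma_series s q"
  unfolding sigma_series_def
  by (rule summable_sums[OF summable_norm_cancel[OF sigma_series_summable[OF assms]]])

lemma sigma_series_deriv:
  fixes q :: complex
  assumes "norm q < 1"
  obtains D where "(sigma_series s has_field_derivative D) (at q)"
    and "(\<lambda>n. of_nat n * of_int (sigma_star s n) * q ^ n) sums (q * D)"
proof -
  let ?c = "\<lambda>n. of_int (sigma_star s n) :: complex"
  have sm: "summable (\<lambda>n. ?c n * z ^ n)" if "norm z < 1" for z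
    using sigma_series_sums[OF that] by (rule sums_summable)
  define D where "D = (\<Sum>n. diffs ?c n * q ^ n)"
  have "(sigma_series s has_field_derivative D) (at q)"
    unfolding sigma_series_def D_def using sm assms by (rule termdiffs_strong')
  moreover have "(\<lambda>n. diffs ?c n * q ^ n) sums D"
    unfolding D_def using assms sm by (intro summable_sums termdiff_converges)
  then have "(\<lambda>n. q * (diffs ?c n * q ^ n)) sums (q * D)"
    by (rule sums_mult)
  then have "(\<lambda>n. of_nat (Suc n) * ?c (Suc n) * q ^ Suc n) sums (q * D)"
    by (simp add: diffs_def mult_ac)
  then have "(\<lambda>n. of_nat n * ?c n * q ^ n) sums (q * D)"
    by (subst (asm) sums_Suc_iff) simp
  ultimately show ?thesis by (rule that)
qed

section \<open>Eisenstein series expressed through the divisor-sum series\<close>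

lemma norm_q_of: "Im \<tau> > 0 \<Longrightarrow> norm (q_of \<tau>) < 1"
  by (simp add: q_of_def)

text \<open>Positivity of \<open>\<lambda>(2k)\<close>. Through the Bernoulli relation it also shows
  that the denominator in \<open>E_star\<close> is not 0.\<close>

lemma tanh_half_fps_odd_nz:
  assumes "k \<ge> 1"
  shows "tanh_half_fps $ (2 * k - 1) \<noteq> 0"
proof -
  have "4 * (-1) ^ Suc k * odd_zeta k / pi ^ (2 * k) \<noteq> 0"
    using odd_zeta_pos[OF assms] by simp
  then show ?thesis
    by (simp only: tanh_half_fps_odd_zeta[OF assms] not_False_eq_True)
qed

text \<open>The relation between \<open>tanh_half_fps\<close> and \<open>bernoulli\<close> turns the
  factor \<open>4k / ((1 - 2^(2k)) B(2k))\<close> into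
  \<open>- 4 / ((2k-1)! T(2k-1))\<close>.\<close>

lemma E_star_eq:
  assumes "k \<ge> 1" "Im \<tau> > 0"
  shows "E_star k \<tau> = 1 + 4 / (fact (2 * k - 1) * of_real (tanh_half_fps $ (2 * k - 1))) *
    sigma_series (2 * k - 1) (q_of \<tau>)"
proof -
  let ?T = "tanh_half_fps $ (2 * k - 1)" and ?B = "bernoulli (2 * k)"
  have k2: "2 * k = Suc (2 * k - 1)"
    using assms by simp
  have "(\<lambda>n. of_int (sigma_star (2 * k - 1) (Suc n)) * q_of \<tau> ^ Suc n) sums
      sigma_series (2 * k - 1) (q_of \<tau>)"
    using sigma_series_sums[OF norm_q_of[OF assms(2)], of "2 * k - 1"] by (subst sums_Suc_iff) simp
  then have s: "(\<Sum>n. of_int (sigma_star (2 * k - 1) (Suc n)) * q_of \<tau> ^ Suc n) =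
      sigma_series (2 * k - 1) (q_of \<tau>)"
    by (rule sums_unique[symmetric])
  have "fact (2 * k) * ?T = - 2 * (1 - 2 ^ (2 * k)) * ?B"
    using tanh_half_fps_bernoulli[of "2 * k - 1"] assms(1) unfolding k2[symmetric] by simp
  moreover have "fact (2 * k) = 2 * real k * fact (2 * k - 1)"
    by (subst k2, subst fact_Suc) (use assms in \<open>simp add: of_nat_diff\<close>)
  ultimately have eq: "2 * real k * fact (2 * k - 1) * ?T = - 2 * (1 - 2 ^ (2 * k)) * ?B"
    by simp
  have T: "?T \<noteq> 0"
    using assms(1) by (rule tanh_half_fps_odd_nz)
  then have nz: "(1 - 2 ^ (2 * k)) * ?B \<noteq> 0"
    using eq assms(1) by auto
  have "1 / (1 - 2 ^ (2 * k)) * (4 * real k / ?B) = - (4 / (fact (2 * k - 1) * ?T))"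
    using eq nz T by (simp add: divide_simps) (simp add: algebra_simps)
  then have "of_real (1 / (1 - 2 ^ (2 * k)) * (4 * real k / ?B)) =
      (of_real (- (4 / (fact (2 * k - 1) * ?T))) :: complex)"
    by (simp only:)
  then have "1 / (1 - 2 ^ (2 * k)) * (4 * of_nat k / of_real ?B) =
      - (4 / (fact (2 * k - 1) * of_real ?T) :: complex)"
    by simp
  then show ?thesis
    unfolding E_star_def s by simp
qed

lemma q_deriv_E_star:
  assumes "k \<ge> 1" "Im \<tau> > 0"
  obtains D where "q_deriv (E_star k) \<tau> = 4 / (fact (2 * k - 1) * of_real (tanh_half_fps $ (2 * k - 1))) * D"
    and "(\<lambda>n. of_nat n * of_int (sigma_star (2 * k - 1) n) * q_of \<tau> ^ n) sums D"
proof -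
  let ?C = "4 / (fact (2 * k - 1) * of_real (tanh_half_fps $ (2 * k - 1))) :: complex"
  obtain D where D: "(sigma_series (2 * k - 1) has_field_derivative D) (at (q_of \<tau>))"
    and sums: "(\<lambda>n. of_nat n * of_int (sigma_star (2 * k - 1) n) * q_of \<tau> ^ n) sums (q_of \<tau> * D)"
    using sigma_series_deriv[OF norm_q_of[OF assms(2)]] by blast
  have q: "(q_of has_field_derivative 2 * of_real pi * \<i> * q_of \<tau>) (at \<tau>)"
    unfolding q_of_def by (auto intro!: derivative_eq_intros)
  have "((\<lambda>z. 1 + ?C * sigma_series (2 * k - 1) (q_of z)) has_field_derivative
      ?C * (D * (2 * of_real pi * \<i> * q_of \<tau>))) (at \<tau>)"
    using DERIV_add[OF DERIV_const[of 1] DERIV_cmult[OF DERIV_chain2[OF D q], of ?C]]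
    by (simp only: add_0_left)
  \<comment> \<open>The expression through \<open>sigma_series\<close> is available on the upper
    half-plane; as this set is open, the derivative carries over.\<close>
  then have "(E_star k has_field_derivative ?C * (D * (2 * of_real pi * \<i> * q_of \<tau>))) (at \<tau>)"
    by (rule has_field_derivative_transform_within_open[where S = "{z. Im z > 0}"])
       (use assms in \<open>auto simp: open_halfspace_Im_gt E_star_eq\<close>)
  then have "q_deriv (E_star k) \<tau> = ?C * (q_of \<tau> * D)"
    unfolding q_deriv_def by (simp add: DERIV_imp_deriv mult_ac)
  then show ?thesis
    using sums by (rule that)
qed

text \<open>The generating-function form of \<open>sigma_star_recurrence\<close>; by absolute
  convergence the convolutions become products of series.\<close>

lemma sigma_series_identity:
  assumes "m \<ge> 2" "norm q < 1"
    and "(\<lambda>n. of_nat n * of_int (sigma_star (2 * m - 3) n) * q ^ n) sums D"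
  shows "2 * D = fact (2 * m - 2) * (\<Sum>k = 1..m - 1. of_real (tanh_half_fps $ (2 * k - 1)) *
      sigma_series (2 * m - 2 * k - 1) q / fact (2 * m - 2 * k - 1)) +
    2 * fact (2 * m - 2) * (\<Sum>k = 1..m - 1.
      sigma_series (2 * k - 1) q * sigma_series (2 * m - 2 * k - 1) q /
      (fact (2 * k - 1) * fact (2 * m - 2 * k - 1))) +
    sigma_series (2 * m - 1) q"
proof -
  let ?c = "\<lambda>s n. of_int (sigma_star s n) :: complex"
  note S = sigma_series_sums[OF assms(2)]
  have conv: "(\<lambda>n. of_int (\<Sum>i\<le>n. sigma_star s i * sigma_star t (n - i)) * q ^ n) sums
      (sigma_series s q * sigma_series t q)" for s t
  proof -
    have "(\<lambda>n. \<Sum>i\<le>n. (?c s i * q ^ i) * (?c t (n - i) * q ^ (n - i))) sums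
        (sigma_series s q * sigma_series t q)"
      unfolding sigma_series_def
      using assms(2) by (intro Cauchy_product_sums sigma_series_summable)
    moreover have "(\<Sum>i\<le>n. (?c s i * q ^ i) * (?c t (n - i) * q ^ (n - i))) =
        of_int (\<Sum>i\<le>n. sigma_star s i * sigma_star t (n - i)) * q ^ n" for n
    proof -
      have "q ^ n = q ^ i * q ^ (n - i)" if "i \<le> n" for i
        using that by (simp flip: power_add)
      then show ?thesis
        unfolding of_int_sum sum_distrib_right by (intro sum.cong refl) simp
    qed
    ultimately show ?thesis by simp
  qed
  have "(\<lambda>n. fact (2 * m - 2) * (\<Sum>k = 1..m - 1. of_real (tanh_half_fps $ (2 * k - 1)) *
      (?c (2 * m - 2 * k - 1) n * q ^ n) / fact (2 * m - 2 * k - 1)) +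
    2 * fact (2 * m - 2) * (\<Sum>k = 1..m - 1.
      (of_int (\<Sum>i\<le>n. sigma_star (2 * k - 1) i * sigma_star (2 * m - 2 * k - 1) (n - i)) * q ^ n) /
      (fact (2 * k - 1) * fact (2 * m - 2 * k - 1))) +
    ?c (2 * m - 1) n * q ^ n) sums
    (fact (2 * m - 2) * (\<Sum>k = 1..m - 1. of_real (tanh_half_fps $ (2 * k - 1)) *
      sigma_series (2 * m - 2 * k - 1) q / fact (2 * m - 2 * k - 1)) +
    2 * fact (2 * m - 2) * (\<Sum>k = 1..m - 1.
      sigma_series (2 * k - 1) q * sigma_series (2 * m - 2 * k - 1) q /
      (fact (2 * k - 1) * fact (2 * m - 2 * k - 1))) +
    sigma_series (2 * m - 1) q)" (is "?f sums ?R")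
    by (intro sums_add sums_mult sums_sum sums_divide S conv)
  moreover have "?f n = 2 * (of_nat n * ?c (2 * m - 3) n * q ^ n)" for n
  proof -
    have "2 * of_nat n * ?c (2 * m - 3) n = of_real (2 * real n * of_int (sigma_star (2 * m - 3) n))"
      by simp
    also have "\<dots> = fact (2 * m - 2) * (\<Sum>k = 1..m - 1. of_real (tanh_half_fps $ (2 * k - 1)) *
        ?c (2 * m - 2 * k - 1) n / fact (2 * m - 2 * k - 1)) +
      2 * fact (2 * m - 2) * (\<Sum>k = 1..m - 1.
        of_int (\<Sum>i\<le>n. sigma_star (2 * k - 1) i * sigma_star (2 * m - 2 * k - 1) (n - i)) /
        (fact (2 * k - 1) * fact (2 * m - 2 * k - 1))) +
      ?c (2 * m - 1) n"
      unfolding sigma_star_recurrence[OF assms(1)] by simp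
    finally have "2 * of_nat n * ?c (2 * m - 3) n * q ^ n = \<dots> * q ^ n"
      by simp
    also have "\<dots> = ?f n"
      by (simp only: distrib_right sum_distrib_left sum_distrib_right times_divide_eq_left
          times_divide_eq_right mult.assoc)
    finally show ?thesis by (simp add: mult.assoc)
  qed
  ultimately have "(\<lambda>n. 2 * (of_nat n * ?c (2 * m - 3) n * q ^ n)) sums ?R"
    by (simp only:)
  then show ?thesis
    using sums_mult[OF assms(3), of 2] by (rule sums_unique2[rotated])
qed

theorem theorem2p24:
  fixes m :: nat and \<tau> :: complex
  assumes "m \<ge> 2" and "Im \<tau> > 0"
  shows "q_deriv (E_star (m - 1)) \<tau> =
    of_nat (2 * m - 2) / (of_real pi ^ 2 * dirichlet_lambda (of_nat (2 * m - 2))) *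
    (\<Sum>k = 1..m - 1.
       dirichlet_lambda (of_nat (2 * k)) * dirichlet_lambda (of_nat (2 * m - 2 * k)) *
       (E_star k \<tau> * E_star (m - k) \<tau> - E_star m \<tau>))"
proof -
  \<comment> \<open>With this scaling \<open>t k * E_star k \<tau> = t k + 4 * S k\<close>, and
    \<open>\<lambda>(2k)\<close> is \<open>t k / 4\<close> up to a sign and a power of
    \<open>pi\<close>. In a product \<open>\<lambda>(2k) \<lambda>(2m-2k)\<close> these combine to
    \<open>\<epsilon>\<close>, which does not depend on \<open>k\<close>.\<close>
  define t :: "nat \<Rightarrow> complex" where "t k = of_real (tanh_half_fps $ (2 * k - 1))" for k
  define S where "S k = sigma_series (2 * k - 1) (q_of \<tau>) / fact (2 * k - 1)" for k
  define \<epsilon> :: complex where "\<epsilon> = (-1) ^ m * of_real pi ^ (2 * m)"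
  have \<epsilon>: "\<epsilon> \<noteq> 0" by (simp add: \<epsilon>_def)
  have t: "t k \<noteq> 0" if "k \<ge> 1" for k
    using tanh_half_fps_odd_nz[OF that] by (simp add: t_def)
  have lambda: "dirichlet_lambda (of_nat (2 * k)) = (-1) ^ Suc k * of_real pi ^ (2 * k) * t k / 4"
    if "k \<ge> 1" for k
  proof -
    have "(-1) ^ Suc k * ((-1) ^ Suc k * x) = x" for x :: real
      by (simp flip: mult.assoc power_add)
    then have "odd_zeta k = (-1) ^ Suc k * pi ^ (2 * k) * tanh_half_fps $ (2 * k - 1) / 4"
      unfolding tanh_half_fps_odd_zeta[OF that] by (simp del: power_Suc)
    then show ?thesis
      unfolding dirichlet_lambda_even[OF that] t_def by simp
  qed
  have E: "t k * E_star k \<tau> = t k + 4 * S k" if "k \<ge> 1" for k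
    unfolding E_star_eq[OF that assms(2)] using t[OF that] by (simp add: t_def S_def field_simps)
  obtain D where D: "q_deriv (E_star (m - 1)) \<tau> = 4 / (fact (2 * m - 3) * t (m - 1)) * D"
    and D_sums: "(\<lambda>n. of_nat n * of_int (sigma_star (2 * m - 3) n) * q_of \<tau> ^ n) sums D"
  proof -
    have "2 * (m - 1) - 1 = 2 * m - 3" by simp
    then show ?thesis
      using q_deriv_E_star[of "m - 1" \<tau> thesis] assms that unfolding t_def by fastforce
  qed
  define A where "A = (\<Sum>k = 1..m - 1. t k * S (m - k))"
  define B where "B = (\<Sum>k = 1..m - 1. S k * S (m - k))"
  have fact_m: "fact (2 * m - 1) = (2 * of_nat m - 1) * (fact (2 * m - 2) :: complex)"
  proof -
    have "2 * m - 1 = Suc (2 * m - 2)" using assms by simp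
    then show ?thesis using assms by (simp add: of_nat_diff algebra_simps)
  qed
  have id: "2 * D = fact (2 * m - 2) * (A + 2 * B + (2 * of_nat m - 1) * S m)"
  proof -
    have "(2 * of_nat m - 1 :: complex) \<noteq> 0"
      using fact_m by (metis fact_nonzero mult_zero_left)
    then have "fact (2 * m - 2) * ((2 * of_nat m - 1) * S m) = sigma_series (2 * m - 1) (q_of \<tau>)"
      unfolding S_def fact_m by simp
    then show ?thesis
      unfolding sigma_series_identity[OF assms(1) norm_q_of[OF assms(2)] D_sums]
      by (simp add: A_def B_def S_def t_def diff_mult_distrib2 distrib_left)
  qed
  have tt: "(\<Sum>k = 1..m - 1. t k * t (m - k)) = - 2 * (2 * of_nat m - 1) * t m"
  proof -
    have "(\<Sum>k = 1..m - 1. t k * t (m - k)) = of_real (\<Sum>k = 1..m - 1.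
        tanh_half_fps $ (2 * k - 1) * tanh_half_fps $ (2 * m - 2 * k - 1))"
      by (simp add: t_def diff_mult_distrib2)
    then show ?thesis
      unfolding tanh_half_fps_recurrence[OF assms(1)] by (simp add: t_def)
  qed
  \<comment> \<open>The reflection of \<open>k\<close> to \<open>m - k\<close> identifies the two
    cross terms of the product.\<close>
  have A': "(\<Sum>k = 1..m - 1. S k * t (m - k)) = A"
    unfolding A_def
    by (rule sum.reindex_bij_witness[where i = "\<lambda>k. m - k" and j = "\<lambda>k. m - k"]) auto
  have "(\<Sum>k = 1..m - 1.
       dirichlet_lambda (of_nat (2 * k)) * dirichlet_lambda (of_nat (2 * m - 2 * k)) *
       (E_star k \<tau> * E_star (m - k) \<tau> - E_star m \<tau>)) =
     (\<Sum>k = 1..m - 1. \<epsilon> / 16 * ((t k + 4 * S k) * (t (m - k) + 4 * S (m - k))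
       - t k * t (m - k) * E_star m \<tau>))"
  proof (rule sum.cong)
    fix k assume k: "k \<in> {1..m - 1}"
    then have k': "k \<ge> 1" "m - k \<ge> 1" "2 * m - 2 * k = 2 * (m - k)" by auto
    have "(-1 :: complex) ^ Suc k * (-1) ^ Suc (m - k) = (-1) ^ m"
      "complex_of_real pi ^ (2 * k) * of_real pi ^ (2 * (m - k)) = of_real pi ^ (2 * m)"
      using k by (auto simp: diff_mult_distrib2 simp flip: power_add)
    then have \<epsilon>_split: "\<epsilon> = ((-1) ^ Suc k * (-1) ^ Suc (m - k)) *
        (of_real pi ^ (2 * k) * of_real pi ^ (2 * (m - k)))"
      by (simp only: \<epsilon>_def)
    show "dirichlet_lambda (of_nat (2 * k)) * dirichlet_lambda (of_nat (2 * m - 2 * k)) *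
       (E_star k \<tau> * E_star (m - k) \<tau> - E_star m \<tau>) =
       \<epsilon> / 16 * ((t k + 4 * S k) * (t (m - k) + 4 * S (m - k)) - t k * t (m - k) * E_star m \<tau>)"
      unfolding k'(3) lambda[OF k'(1)] lambda[OF k'(2)] \<epsilon>_split E[OF k'(1), symmetric] E[OF k'(2), symmetric]
      by (simp add: algebra_simps)
  qed simp
  also have "\<dots> = \<epsilon> / 16 * ((\<Sum>k = 1..m - 1. t k * t (m - k)) + 4 * A
      + 4 * (\<Sum>k = 1..m - 1. S k * t (m - k)) + 16 * B
      - (\<Sum>k = 1..m - 1. t k * t (m - k)) * E_star m \<tau>)"
    unfolding A_def B_def sum_distrib_left sum_distrib_right sum.distrib[symmetric] sum_subtractf[symmetric]
    by (intro sum.cong refl) (simp add: algebra_simps)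
  also have "\<dots> = \<epsilon> / 16 * (- 2 * (2 * of_nat m - 1) * t m + 8 * A + 16 * B
      + 2 * (2 * of_nat m - 1) * (t m * E_star m \<tau>))"
    unfolding tt A' by (simp add: algebra_simps)
  \<comment> \<open>Inserting this cancels the constant terms, which is the purpose of subtracting
    \<open>E_star m \<tau>\<close>.\<close>
  also have "t m * E_star m \<tau> = t m + 4 * S m"
    using assms by (intro E) simp
  also have "\<epsilon> / 16 * (- 2 * (2 * of_nat m - 1) * t m + 8 * A + 16 * B
      + 2 * (2 * of_nat m - 1) * (t m + 4 * S m)) = \<epsilon> / 2 * (A + 2 * B + (2 * of_nat m - 1) * S m)"
    by (simp add: field_simps)
  also have "A + 2 * B + (2 * of_nat m - 1) * S m = 2 * D / fact (2 * m - 2)"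
    unfolding id by simp
  finally have sum_eq: "(\<Sum>k = 1..m - 1.
       dirichlet_lambda (of_nat (2 * k)) * dirichlet_lambda (of_nat (2 * m - 2 * k)) *
       (E_star k \<tau> * E_star (m - k) \<tau> - E_star m \<tau>)) = \<epsilon> * D / fact (2 * m - 2)"
    by simp
  \<comment> \<open>The factor \<open>pi^2\<close> raises the power of \<open>pi\<close> to
    \<open>2 * m\<close>, and the sign of \<open>\<lambda>(2m-2)\<close> is \<open>(-1) ^ m\<close>;
    together they give the same \<open>\<epsilon>\<close>.\<close>
  have lam: "of_real pi ^ 2 * dirichlet_lambda (of_nat (2 * m - 2)) = \<epsilon> * t (m - 1) / 4"
  proof -
    have m: "2 * m - 2 = 2 * (m - 1)" "m = Suc (m - 1)" "2 * m = 2 + 2 * (m - 1)" "m - 1 \<ge> 1"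
      using assms by auto
    have "\<epsilon> = (-1) ^ Suc (m - 1) * (of_real pi ^ 2 * of_real pi ^ (2 * (m - 1)))"
      unfolding \<epsilon>_def power_add[symmetric] m(3)[symmetric] m(2)[symmetric] ..
    then show ?thesis
      unfolding m(1) lambda[OF m(4)] by (simp add: mult_ac)
  qed
  have fact_M: "fact (2 * m - 2) = of_nat (2 * m - 2) * (fact (2 * m - 3) :: complex)"
  proof -
    have "2 * m - 2 = Suc (2 * m - 3)" using assms by simp
    then show ?thesis by (simp only: fact_Suc of_nat_mult of_nat_fact)
  qed
  have "of_nat (2 * m - 2) \<noteq> (0 :: complex)"
    using assms by (simp only: of_nat_eq_0_iff)
  \<comment> \<open>Here \<open>M = 2 * m - 2\<close>, \<open>e = \<epsilon>\<close>,
    \<open>f\<close> is the factorial of \<open>2 * m - 3\<close> and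
    \<open>u = t (m - 1)\<close>.\<close>
  moreover have "4 / (f * u) * D = M / (e * u / 4) * (e * D / (M * f))"
    if "M \<noteq> 0" "e \<noteq> 0" for M e f u :: complex
    using that by simp
  ultimately show ?thesis
    unfolding sum_eq lam D fact_M using \<epsilon> by blast
qed

end
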